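(* Let $\Gamma$ be a Coxeter graph with finite vertex set $S$, and let $X,Y\subseteq S$. Then $\mathrm{VA}_X[\Gamma]\cap\mathrm{VA}_Y[\Gamma]=\mathrm{VA}_{X\cap Y}[\Gamma]$.
   Context: A Coxeter matrix over a finite set $S$ is a symmetric matrix $M=(m_{s,t})_{s,t\in S}$ with entries in $\mathbb{N}_{\ge 1}\cup\{\infty\}$, such that $m_{s,s}=1$ for all $s$ and $m_{s,t}=m_{t,s}\ge 2$ for all $s\neq t$. Its Coxeter graph $\Gamma$ has vertex set $S$; distinct $s,t$ are joined by an edge iff $m_{s,t}\ge 3$, and the edge is labeled by $m_{s,t}$ if $m_{s,t}\ge 4$. Thus $\Gamma$ and $M$ determine each other. For letters $a,b$ and an integer $m\geq 1$, $\Pi(a,b,m)$ denotes the alternating product $aba\cdots$ of length $m$. The virtual Artin group $\mathrm{VA}[\Gamma]$ is the group generated by $\mathcal{S}\sqcup\mathcal{T}$, where $\mathcal{S}=\{\sigma_s\mid s\in S\}$ and $\mathcal{T}=\{\tau_s\mid s\in S\}$ are in one-to-one correspondence with $S$, subject to the relations: (v1) $\Pi(\sigma_s,\sigma_t,m_{s,t})=\Pi(\sigma_t,\sigma_s,m_{s,t})$ for $s\ne t$ with $m_{s,t}\ne\infty$; (v2) $\tau_s^2=1$ for $s\in S$, and $\Pi(\tau_s,\tau_t,m_{s,t})=\Pi(\tau_t,\tau_s,m_{s,t})$ for $s\ne t$ with $m_{s,t}\neq\infty$; (v3) $\sigma_s\,\Pi(\tau_t,\tau_s,m_{s,t}-1)=\Pi(\tau_t,\tau_s,m_{s,t}-1)\,\sigma_r$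 for $s\neq t$ with $m_{s,t}\ne\infty$, where $r=s$ if $m_{s,t}$ is even and $r=t$ if $m_{s,t}$ is odd. For $X\subseteq S$, $\mathrm{VA}_X[\Gamma]$ denotes the subgroup of $\mathrm{VA}[\Gamma]$ generated by $\{\sigma_x\mid x\in X\}\sqcup\{\tau_x\mid x\in X\}$ (a standard parabolic subgroup). *)

theory Defs
  imports "HOL-Algebra.Generated_Groups" "HOL-Library.Extended_Nat"
begin

section \<open>Groups given by generators and relations\<close>

text \<open>
  A letter \<open>(g, True)\<close> stands for the generator \<open>g\<close> and \<open>(g, False)\<close> for its formal
  inverse. A relation \<open>u = v\<close> is the pair of words \<open>(u, v)\<close>.
\<close>

type_synonym 'g word = "('g \<times> bool) list"

definition words :: "'g set \<Rightarrow> 'g word set" where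
  "words A = lists (A \<times> UNIV)"

inductive_set word_cong :: "'g set \<Rightarrow> ('g word \<times> 'g word) set \<Rightarrow> ('g word \<times> 'g word) set"
  for A :: "'g set" and R :: "('g word \<times> 'g word) set" where
  refl: "u \<in> words A \<Longrightarrow> (u, u) \<in> word_cong A R"
| sym: "(u, v) \<in> word_cong A R \<Longrightarrow> (v, u) \<in> word_cong A R"
| trans: "(u, v) \<in> word_cong A R \<Longrightarrow> (v, w) \<in> word_cong A R \<Longrightarrow> (u, w) \<in> word_cong A R"
| append: "(u, u') \<in> word_cong A R \<Longrightarrow> (v, v') \<in> word_cong A R \<Longrightarrow>
    (u @ v, u' @ v') \<in> word_cong A R"
| cancel: "g \<in> A \<Longrightarrow> ([(g, b), (g, \<not> b)], []) \<in> word_cong A R"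
| rel: "(u, v) \<in> R \<Longrightarrow> u \<in> words A \<Longrightarrow> v \<in> words A \<Longrightarrow> (u, v) \<in> word_cong A R"

definition word_class :: "'g set \<Rightarrow> ('g word \<times> 'g word) set \<Rightarrow> 'g word \<Rightarrow> 'g word set" where
  "word_class A R w = word_cong A R `` {w}"

definition presented_group :: "'g set \<Rightarrow> ('g word \<times> 'g word) set \<Rightarrow> 'g word set monoid" where
  "presented_group A R =
    \<lparr>carrier = words A // word_cong A R,
     mult = (\<lambda>C D. \<Union>u\<in>C. \<Union>v\<in>D. word_class A R (u @ v)),
     one = word_class A R []\<rparr>"

lemma word_cong_words: "(u, v) \<in> word_cong A R \<Longrightarrow> u \<in> words A \<and> v \<in> words A"
  by (induction rule: word_cong.induct) (auto simp: words_def)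

lemma equiv_word_cong: "equiv (words A) (word_cong A R)"
proof (rule equivI)
  show "refl_on (words A) (word_cong A R)"
    by (simp add: refl_on_def word_cong.refl)
  show "word_cong A R \<subseteq> words A \<times> words A"
    using word_cong_words by fast
  show "Relation.sym (word_cong A R)"
    by (rule symI) (rule word_cong.sym)
  show "Relation.trans (word_cong A R)"
    by (rule transI) (rule word_cong.trans)
qed

lemma mult_word_class:
  assumes "u \<in> words A" "v \<in> words A"
  shows "word_class A R u \<otimes>\<^bsub>presented_group A R\<^esub> word_class A R v = word_class A R (u @ v)"
proof -
  have eq: "word_class A R (u' @ v') = word_class A R (u @ v)"
    if "u' \<in> word_class A R u" "v' \<in> word_class A R v" for u' v'
  proof -
    have "(u @ v, u' @ v') \<in> word_cong A R"
      using that by (intro word_cong.append) (auto simp: word_class_def)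
    then show ?thesis
      unfolding word_class_def by (rule equiv_class_eq[OF equiv_word_cong, symmetric])
  qed
  have "u \<in> word_class A R u" "v \<in> word_class A R v"
    using assms by (simp_all add: word_class_def word_cong.refl)
  then have "(\<Union>u'\<in>word_class A R u. \<Union>v'\<in>word_class A R v. word_class A R (u' @ v')) =
      word_class A R (u @ v)"
    using eq by blast
  then show ?thesis
    by (simp add: presented_group_def)
qed

lemma inverse_word:
  assumes "w \<in> words A"
  obtains v where "v \<in> words A" "(v @ w, []) \<in> word_cong A R"
proof -
  have "\<exists>v\<in>words A. (v @ w, []) \<in> word_cong A R"
    using assms
  proof (induction w)
    case Nil
    then show ?case by (intro bexI[of _ "[]"]) (simp_all add: words_def word_cong.refl)
  next
    case (Cons a w)
    obtain g b where a: "a = (g, b)" by (cases a)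
    have g: "g \<in> A" and w: "w \<in> words A" using Cons.prems a by (auto simp: words_def)
    obtain v where v: "v \<in> words A" "(v @ w, []) \<in> word_cong A R"
      using Cons.IH w by blast
    have "([(g, \<not> b), (g, b)], []) \<in> word_cong A R"
      using word_cong.cancel[OF g, of "\<not> b" R] by simp
    then have "(v @ [(g, \<not> b), (g, b)] @ w, v @ [] @ w) \<in> word_cong A R"
      using word_cong.append[OF word_cong.refl[OF v(1)] word_cong.append[OF _ word_cong.refl[OF w]]]
      by blast
    then have "((v @ [(g, \<not> b)]) @ a # w, []) \<in> word_cong A R"
      using word_cong.trans[OF _ v(2)] a by simp
    moreover have "v @ [(g, \<not> b)] \<in> words A" using v(1) g by (auto simp: words_def)
    ultimately show ?case by blast
  qed
  then show ?thesis using that by blast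
qed

lemma group_presented_group: "group (presented_group A R)"
proof (rule groupI)
  let ?G = "presented_group A R"
  have carr: "carrier ?G = word_class A R ` words A"
    by (auto simp: presented_group_def word_class_def quotient_def)
  have one: "\<one>\<^bsub>?G\<^esub> = word_class A R []"
    by (simp add: presented_group_def)
  have nil: "[] \<in> words A" by (simp add: words_def)
  have app: "u @ v \<in> words A" if "u \<in> words A" "v \<in> words A" for u v
    using that by (simp add: words_def)
  show "x \<otimes>\<^bsub>?G\<^esub> y \<in> carrier ?G" if "x \<in> carrier ?G" "y \<in> carrier ?G" for x y
    using that by (auto simp: carr mult_word_class app)
  show "\<one>\<^bsub>?G\<^esub> \<in> carrier ?G"
    using nil by (auto simp: carr one)
  show "x \<otimes>\<^bsub>?G\<^esub> y \<otimes>\<^bsub>?G\<^esub> z = x \<otimes>\<^bsub>?G\<^esub> (y \<otimes>\<^bsub>?G\<^esub> z)"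
    if "x \<in> carrier ?G" "y \<in> carrier ?G" "z \<in> carrier ?G" for x y z
    using that by (auto simp: carr mult_word_class app)
  show "\<one>\<^bsub>?G\<^esub> \<otimes>\<^bsub>?G\<^esub> x = x" if "x \<in> carrier ?G" for x
    using that nil by (auto simp: carr one mult_word_class)
  show "\<exists>y\<in>carrier ?G. y \<otimes>\<^bsub>?G\<^esub> x = \<one>\<^bsub>?G\<^esub>" if x: "x \<in> carrier ?G" for x
  proof -
    obtain w where w: "w \<in> words A" "x = word_class A R w"
      using x by (auto simp: carr)
    obtain v where v: "v \<in> words A" "(v @ w, []) \<in> word_cong A R"
      using inverse_word w(1) by blast
    have "word_class A R (v @ w) = word_class A R []"
      unfolding word_class_def using v(2) by (rule equiv_class_eq[OF equiv_word_cong])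
    then show ?thesis
      using v(1) w by (auto simp: carr one mult_word_class)
  qed
qed

section \<open>Coxeter matrices and virtual Artin groups\<close>

text \<open>
  A Coxeter graph and its Coxeter matrix determine each other; the Coxeter graph with vertex
  set \<open>S\<close> is represented by its matrix, of which only the entries indexed by \<open>S\<close> matter.
  Finiteness of \<open>S\<close> is not part of the predicate.
\<close>

definition coxeter_matrix :: "'s set \<Rightarrow> ('s \<Rightarrow> 's \<Rightarrow> enat) \<Rightarrow> bool" where
  "coxeter_matrix S m \<longleftrightarrow>
    (\<forall>s\<in>S. m s s = 1) \<and> (\<forall>s\<in>S. \<forall>t\<in>S. s \<noteq> t \<longrightarrow> m s t = m t s \<and> 2 \<le> m s t)"

fun alternating :: "'a \<Rightarrow> 'a \<Rightarrow> nat \<Rightarrow> 'a list" where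
  "alternating a b 0 = []"
| "alternating a b (Suc n) = a # alternating b a n"

datatype 's va_generator = Sigma 's | Tau 's

abbreviation sigma :: "'s \<Rightarrow> 's va_generator \<times> bool" where
  "sigma s \<equiv> (Sigma s, True)"

abbreviation tau :: "'s \<Rightarrow> 's va_generator \<times> bool" where
  "tau s \<equiv> (Tau s, True)"

definition va_generators :: "'s set \<Rightarrow> 's va_generator set" where
  "va_generators X = Sigma ` X \<union> Tau ` X"

text \<open>The condition \<open>m s t = enat k\<close> expresses that \<open>m s t\<close> is finite, with value \<open>k\<close>.\<close>

definition va_relations ::
  "'s set \<Rightarrow> ('s \<Rightarrow> 's \<Rightarrow> enat) \<Rightarrow> ('s va_generator word \<times> 's va_generator word) set" where
  "va_relations S m =
    {(alternating (sigma s) (sigma t) k, alternating (sigma t) (sigma s) k) | s t k.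
       s \<in> S \<and> t \<in> S \<and> s \<noteq> t \<and> m s t = enat k} \<union>
    {([tau s, tau s], []) | s. s \<in> S} \<union>
    {(alternating (tau s) (tau t) k, alternating (tau t) (tau s) k) | s t k.
       s \<in> S \<and> t \<in> S \<and> s \<noteq> t \<and> m s t = enat k} \<union>
    {([sigma s] @ alternating (tau t) (tau s) (k - 1),
      alternating (tau t) (tau s) (k - 1) @ [sigma (if even k then s else t)]) | s t k.
       s \<in> S \<and> t \<in> S \<and> s \<noteq> t \<and> m s t = enat k}"

definition virtual_artin_group ::
  "'s set \<Rightarrow> ('s \<Rightarrow> 's \<Rightarrow> enat) \<Rightarrow> 's va_generator word set monoid" where
  "virtual_artin_group S m = presented_group (va_generators S) (va_relations S m)"

definition va_parabolic ::
  "'s set \<Rightarrow> ('s \<Rightarrow> 's \<Rightarrow> enat) \<Rightarrow> 's set \<Rightarrow> 's va_generator word set set" where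
  "va_parabolic S m X =
    generate (virtual_artin_group S m)
      ((\<lambda>g. word_class (va_generators S) (va_relations S m) [(g, True)]) ` va_generators X)"

end

theory Submission
  imports Defs Complex_Main
begin

text \<open>
  Let \<open>W\<close> be the Coxeter group of \<open>\<Gamma>\<close>, embedded in the virtual Artin group through the \<open>\<tau> s\<close>. The
  conjugates of the \<open>\<sigma> s\<close> by elements of \<open>W\<close> depend only on the corresponding root, and they
  satisfy the Artin relations of a Coxeter matrix indexed by the (usually infinitely many)
  roots. An element of the virtual Artin group is thus a product of an element of the Artin
  group over the roots and an element of \<open>W\<close>. For Artin groups over an arbitrary index set,
  Blufstein and Paris construct a map of sets onto the standard parabolic subgroup of \<open>X\<close> that
  is the identity on it: follow a word through the cosets of the parabolic subgroup of the
  Coxeter group and record a letter whenever it fixes the current coset. This map sends a word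
  in the letters \<open>Y\<close> to a word in \<open>X \<inter> Y\<close>. Applied to the roots of \<open>X\<close> and of \<open>Y\<close>, and combined
  with the same statement for \<open>W\<close>, this gives the theorem.
\<close>

section \<open>Presented groups as type class groups\<close>

text \<open>The retraction is only a map of sets, so it cannot be given on generators and extended.
  It is realized by an automaton (\<open>act\<close>) that reads words of the virtual Artin group; a
  word may be replaced by an equal one because the two sides of each defining relation lead every
  \<open>valid\<close> state to the same state. Recorded letters are multiplied inside the virtual
  Artin group itself, through \<open>\<delta>\<close>; cosets are tracked in a Coxeter group whose
  generators are the roots (\<open>hat\<close>). The delicate case is a braid relation between two
  roots: the recorded words must be equal or be the two sides of a braid relation with the same
  exponent. To compare exponents, \<open>r s + r t\<close> must have order exactly
  \<open>m s t\<close>, and a linear representation enters only to prove this. The remaining Coxeter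
  theory rests on parities of reflections (\<open>inversion\<close>), which make sense over any
  index set, as the roots demand. Accordingly a root is encoded not as a vector but as a reflection
  with a sign.\<close>

text \<open>Groups are written additively, so that the noncommutative type class \<open>group_add\<close> applies.\<close>

typedef 'a symmetry = "{f :: 'a \<Rightarrow> 'a. bij f}"
  morphisms apply_symmetry Symmetry
  by (rule exI[of _ id]) simp

setup_lifting type_definition_symmetry

instantiation symmetry :: (type) group_add
begin

lift_definition zero_symmetry :: "'a symmetry" is id by simp
lift_definition plus_symmetry :: "'a symmetry \<Rightarrow> 'a symmetry \<Rightarrow> 'a symmetry" is "(\<circ>)"
  by (simp add: bij_comp)
lift_definition uminus_symmetry :: "'a symmetry \<Rightarrow> 'a symmetry" is "inv_into UNIV"
  by (simp add: bij_imp_bij_inv)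
definition minus_symmetry :: "'a symmetry \<Rightarrow> 'a symmetry \<Rightarrow> 'a symmetry" where
  "minus_symmetry f g = f + - g"

instance
proof
  fix f g h :: "'a symmetry"
  show "f + g + h = f + (g + h)" by transfer (simp add: comp_assoc)
  show "0 + f = f" by transfer simp
  show "f + 0 = f" by transfer simp
  show "- f + f = 0" by transfer (simp add: bij_is_inj)
  show "f + - g = f - g" by (simp add: minus_symmetry_def)
qed

end

definition evaluate :: "('g \<Rightarrow> 'h::group_add) \<Rightarrow> 'g word \<Rightarrow> 'h" where
  "evaluate p u = (\<Sum>(g, b)\<leftarrow>u. if b then p g else - p g)"

lemma evaluate_simps [simp]:
  "evaluate p [] = 0"
  "evaluate p ((g, b) # u) = (if b then p g else - p g) + evaluate p u"
  "evaluate p (u @ v) = evaluate p u + evaluate p v"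
  by (simp_all add: evaluate_def)

text \<open>Only faithfulness on words is demanded: \<open>'h\<close> may be larger than the
  presented group, so later statements are restricted to values of words, such as
  \<open>W\<close>.\<close>

locale group_presentation =
  fixes A :: "'g set" and R :: "('g word \<times> 'g word) set" and p :: "'g \<Rightarrow> 'h::group_add"
  assumes evaluate_eq_iff:
    "u \<in> words A \<Longrightarrow> v \<in> words A \<Longrightarrow> evaluate p u = evaluate p v \<longleftrightarrow> (u, v) \<in> word_cong A R"

lemma words_simps [simp]:
  "[] \<in> words A" "a # u \<in> words A \<longleftrightarrow> fst a \<in> A \<and> u \<in> words A"
  "u @ v \<in> words A \<longleftrightarrow> u \<in> words A \<and> v \<in> words A"
  by (auto simp: words_def mem_Times_iff)

lemma word_class_eq_iff:
  assumes "u \<in> words A" "v \<in> words A"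
  shows "word_class A R u = word_class A R v \<longleftrightarrow> (u, v) \<in> word_cong A R"
  using eq_equiv_class_iff[OF equiv_word_cong assms] by (simp add: word_class_def)

lemma carrier_presented_group: "carrier (presented_group A R) = word_class A R ` words A"
  by (auto simp: presented_group_def word_class_def quotient_def)

lemma one_presented_group: "\<one>\<^bsub>presented_group A R\<^esub> = word_class A R []"
  by (simp add: presented_group_def)

text \<open>The witness is the left regular representation.\<close>

lemma ex_group_presentation:
  fixes A :: "'g set"
  shows "\<exists>p :: 'g \<Rightarrow> 'g word set symmetry. group_presentation A R p"
proof -
  let ?G = "presented_group A R"
  interpret group ?G by (rule group_presented_group)
  \<comment> \<open>Acting as the identity off the carrier lets \<open>f u\<close> be a bijection of
    the whole type.\<close>
  define f where "f u C = (if C \<in> carrier ?G then word_class A R u \<otimes>\<^bsub>?G\<^esub> C else C)" for u C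
  have cl: "word_class A R u \<in> carrier ?G" if "u \<in> words A" for u
    using that by (simp add: carrier_presented_group)
  have f_app: "f (u @ v) = f u \<circ> f v" if "u \<in> words A" "v \<in> words A" for u v
    using that cl by (auto simp: f_def fun_eq_iff m_assoc simp flip: mult_word_class)
  have f_nil: "f [] = id"
    by (simp add: f_def fun_eq_iff flip: one_presented_group)
  have f_cong: "f u = f v" if "(u, v) \<in> word_cong A R" for u v
    using that word_class_eq_iff[of u A v R] word_cong_words[of u v A R] by (simp add: f_def fun_eq_iff)
  have f_inj: "(u, v) \<in> word_cong A R" if "f u = f v" "u \<in> words A" "v \<in> words A" for u v
  proof -
    from fun_cong[OF that(1), of "\<one>\<^bsub>?G\<^esub>"] show ?thesis
      using that(2,3) cl by (simp add: f_def flip: word_class_eq_iff)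
  qed
  have letter: "f [(g, b)] \<circ> f [(g, \<not> b)] = id" if "g \<in> A" for g b
    using f_cong[OF word_cong.cancel[OF that, of b R]] f_app[of "[(g, b)]" "[(g, \<not> b)]"] that f_nil
    by simp
  have bij: "bij (f [(g, b)])" if "g \<in> A" for g b
    using letter[OF that, of b] letter[OF that, of "\<not> b"] by (intro o_bij[of "f [(g, \<not> b)]"]) auto
  have bij_words: "bij (f u)" if "u \<in> words A" for u
    using that
  proof (induction u)
    case (Cons a u)
    obtain g b where a: "a = (g, b)" by (cases a)
    have "f (a # u) = f [a] \<circ> f u" using f_app[of "[a]" u] Cons.prems by simp
    moreover have "bij (f u)" "bij (f [a])" using bij[of g b] Cons a by simp_all
    ultimately show ?case by (simp only: bij_comp)
  qed (simp add: f_nil)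
  define p where "p g = (if g \<in> A then Symmetry (f [(g, True)]) else 0)" for g
  have plus: "Symmetry (f u) + Symmetry (f v) = Symmetry (f (u @ v))"
    if "u \<in> words A" "v \<in> words A" for u v
    using that bij_words f_app by (simp add: plus_symmetry_def Symmetry_inverse)
  have zero: "Symmetry (f []) = 0"
    by (simp add: f_nil zero_symmetry_def)
  have inv: "- Symmetry (f [(g, True)]) = Symmetry (f [(g, False)])" if "g \<in> A" for g
    using plus[of "[(g, True)]" "[(g, False)]"] that f_cong[OF word_cong.cancel[OF that, of True R]] zero
    by (intro minus_unique) simp
  have "evaluate p u = Symmetry (f u)" if "u \<in> words A" for u
    using that
  proof (induction u)
    case (Cons a u)
    obtain g b where a: "a = (g, b)" by (cases a)
    show ?case
      using Cons a plus[of "[a]" u] inv by (cases b) (simp_all add: p_def)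
  qed (simp add: zero)
  then have "evaluate p u = evaluate p v \<longleftrightarrow> (u, v) \<in> word_cong A R"
    if "u \<in> words A" "v \<in> words A" for u v
    using that bij_words f_inj[of u v] f_cong[of u v] by (auto simp: Symmetry_inject)
  then show ?thesis
    by (auto simp: group_presentation_def)
qed

section \<open>Coxeter groups\<close>

lemma length_alternating [simp]: "length (alternating a b n) = n"
  by (induction n arbitrary: a b) auto

lemma map_alternating: "map f (alternating a b n) = alternating (f a) (f b) n"
  by (induction n arbitrary: a b) auto

lemma set_alternating: "set (alternating a b n) \<subseteq> {a, b}"
  by (induction n arbitrary: a b) auto

lemma alternating_add:
  "alternating a b (k + n) =
     alternating a b k @ (if even k then alternating a b n else alternating b a n)"
  by (induction k arbitrary: a b) auto

lemma alternating_Suc_right: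
  "alternating a b (Suc n) = alternating a b n @ [if even n then a else b]"
  using alternating_add[of a b n 1] by simp

lemma rev_alternating:
  "rev (alternating a b n) = (if even n then alternating b a n else alternating a b n)"
proof (induction n arbitrary: a b)
  case (Suc n)
  then show ?case
    using alternating_Suc_right[of a b n] alternating_Suc_right[of b a n] by simp
qed simp

text \<open>For involutive generators this word is one side of a braid relation followed by the
  inverse of the other, so the relation says that it vanishes.\<close>

lemma alternating_double:
  "alternating a b (2 * k) = alternating a b k @ rev (alternating b a k)"
  using alternating_add[of a b k k] by (simp add: rev_alternating mult_2)

lemma coxeter_matrixD:
  assumes "coxeter_matrix S m" "s \<in> S" "t \<in> S"
  shows "m s t = m t s" "s \<noteq> t \<Longrightarrow> m s t = enat k \<Longrightarrow> 2 \<le> k"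
  using assms by (auto simp: coxeter_matrix_def) (metis enat_ord_simps(1) numeral_eq_enat)

definition coxeter_relations :: "('a \<Rightarrow> 'a \<Rightarrow> enat) \<Rightarrow> ('a word \<times> 'a word) set" where
  "coxeter_relations m =
     {([(s, True), (s, True)], []) | s. True} \<union>
     {(alternating (s, True) (t, True) k, alternating (t, True) (s, True) k) | s t k.
        s \<noteq> t \<and> m s t = enat k}"

lemma words_UNIV [simp]: "words UNIV = UNIV"
  by (auto simp: words_def)

text \<open>All of the type \<open>'a\<close> indexes generators, because the locale is used both
  for the given matrix and for the matrix of the roots.\<close>

locale coxeter_system = group_presentation UNIV "coxeter_relations m" r
  for m :: "'a \<Rightarrow> 'a \<Rightarrow> enat" and r :: "'a \<Rightarrow> 'w::group_add" +
  assumes matrix: "coxeter_matrix UNIV m"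
begin

definition ev :: "'a list \<Rightarrow> 'w" where
  "ev xs = sum_list (map r xs)"

lemma ev_simps [simp]:
  "ev [] = 0" "ev (s # xs) = r s + ev xs" "ev (xs @ ys) = ev xs + ev ys"
  by (simp_all add: ev_def)

lemma evaluate_positive: "evaluate r (map (\<lambda>s. (s, True)) xs) = ev xs"
  by (induction xs) auto

lemma sym: "m s t = m t s"
  using coxeter_matrixD(1)[OF matrix] by simp

lemma two_le: "s \<noteq> t \<Longrightarrow> m s t = enat k \<Longrightarrow> 2 \<le> k"
  using coxeter_matrixD(2)[OF matrix] by simp

lemma square [simp]: "r s + r s = 0"
proof -
  have "([(s, True), (s, True)], []) \<in> word_cong UNIV (coxeter_relations m)"
    by (rule word_cong.rel) (auto simp: coxeter_relations_def)
  then show ?thesis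
    using evaluate_eq_iff[of "[(s, True), (s, True)]" "[]"] by simp
qed

lemma uminus [simp]: "- r s = r s"
  by (rule minus_unique) simp

lemma square_assoc [simp]: "r s + (r s + w) = w"
  by (simp flip: add.assoc)

lemma square_right [simp]: "w + r s + r s = w"
  by (simp add: add.assoc)

lemma diff_r: "w - r s = w + r s"
  using add_uminus_conv_diff[of w "r s"] by simp

lemma braid:
  assumes "s \<noteq> t" "m s t = enat k"
  shows "ev (alternating s t k) = ev (alternating t s k)"
proof -
  have "(alternating (s, True) (t, True) k, alternating (t, True) (s, True) k)
      \<in> word_cong UNIV (coxeter_relations m)"
    using assms by (intro word_cong.rel) (auto simp: coxeter_relations_def)
  then show ?thesis
    using evaluate_eq_iff
    by (auto simp flip: evaluate_positive simp: map_alternating)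
qed

lemma fold_eqI:
  assumes "ev xs = ev ys"
    and inv: "\<And>s x. f s (f s x) = x"
    and braid: "\<And>s t k x. s \<noteq> t \<Longrightarrow> m s t = enat k \<Longrightarrow>
      fold f (alternating s t k) x = fold f (alternating t s k) x"
  shows "fold f xs x = fold f ys x"
proof -
  let ?l = "map (\<lambda>s. (s, True))"
  have pos: "fold (\<lambda>a. f (fst a)) (?l zs) = fold f zs" for zs
    by (induction zs) auto
  have "fold (\<lambda>a. f (fst a)) u x = fold (\<lambda>a. f (fst a)) v x"
    if "(u, v) \<in> word_cong UNIV (coxeter_relations m)" for u v x
    using that
  proof (induction arbitrary: x rule: word_cong.induct)
    case (rel u v)
    then show ?case
      using pos inv braid
      by (auto simp: coxeter_relations_def simp flip: map_alternating[of "\<lambda>s. (s, True)"])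
  qed (auto simp: inv)
  moreover have "(?l xs, ?l ys) \<in> word_cong UNIV (coxeter_relations m)"
    using evaluate_eq_iff[of "?l xs" "?l ys"] assms(1) by (simp add: evaluate_positive)
  ultimately show ?thesis
    using pos by metis
qed

lemma ev_rev: "ev (rev xs) = - ev xs"
  by (induction xs) (auto simp: minus_add)

end

lemma conj_eq_iff: "w + t - w = u \<longleftrightarrow> t = - w + u + w" for w t u :: "'g::group_add"
  by (auto simp: diff_eq_eq add.assoc) (metis minus_add_cancel)

lemma count_list_conj:
  "count_list (map (\<lambda>t. w + t - w) xs) x = count_list xs (- w + x + w)"
  for w :: "'g::group_add"
  by (induction xs) (auto simp: conj_eq_iff)

section \<open>The linear representation and the exact order of a product of two generators\<close>

context coxeter_system
begin

lemma fold_involution: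
  assumes "\<And>s x. f s (f s x) = x"
  shows "fold f (rev xs) (fold f xs x) = x" "fold f xs (fold f (rev xs) x) = x"
  using assms by (induction xs arbitrary: x) auto

lemma fold_braidI:
  assumes inv: "\<And>s x. f s (f s x) = x"
    and "\<And>x. fold f (alternating s t (2 * k)) x = x"
  shows "fold f (alternating s t k) x = fold f (alternating t s k) x"
proof -
  let ?xs = "alternating s t k" and ?ys = "alternating t s k"
  have "fold f (rev ?ys) (fold f ?xs x) = x"
    using assms(2)[of x] by (simp add: alternating_double)
  then show ?thesis
    using fold_involution(2)[where f = f and xs = ?ys and x = "fold f ?xs x"] inv by simp
qed

text \<open>
  The contragredient of the geometric representation: off the diagonal, \<open>gram\<close> is \<open>- 2\<close> times the
  invariant bilinear form, and a function \<open>\<phi>\<close> stands for the values of a linear form on the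
  simple roots. Working with linear forms avoids finite support conditions.
\<close>

definition gram :: "'a \<Rightarrow> 'a \<Rightarrow> real" where
  "gram s t = (case m s t of enat k \<Rightarrow> 2 * cos (pi / k) | \<infinity> \<Rightarrow> 2)"

definition reflect :: "'a \<Rightarrow> ('a \<Rightarrow> real) \<Rightarrow> 'a \<Rightarrow> real" where
  "reflect s \<phi> = (\<lambda>u. if u = s then - \<phi> s else \<phi> u + gram s u * \<phi> s)"

lemma gram_sym: "gram s t = gram t s"
  by (simp add: gram_def sym[of s t])

lemma reflect_reflect [simp]: "reflect s (reflect s \<phi>) = \<phi>"
  by (auto simp: reflect_def)

text \<open>
  In suitable coordinates on the orbit of \<open>\<phi>\<close>, the reflections in \<open>s\<close> and \<open>t\<close> are
  \<open>\<psi> \<mapsto> - \<psi>\<close> and \<open>\<psi> \<mapsto> - \<psi> - 2 * pi / k\<close>.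
\<close>

lemma reflect_alternating:
  assumes "s \<noteq> t" "m s t = enat k"
  obtains P :: "real \<Rightarrow> 'a \<Rightarrow> real" and \<psi> R
  where "\<phi> = P \<psi>" "\<And>\<psi> n. fold reflect (alternating s t (2 * n)) (P \<psi>) = P (\<psi> - 2 * n * (pi / k))"
    "\<And>\<psi>. P \<psi> s = R * sin \<psi>" "\<And>\<psi>. P \<psi> t = - R * sin (\<psi> + pi / k)"
    "\<And>\<psi>. P (\<psi> - 2 * pi) = P \<psi>"
proof -
  define \<theta> where "\<theta> = pi / k"
  have k: "2 \<le> k" using two_le assms by simp
  have "0 < \<theta>" "\<theta> < pi" using k by (auto simp: \<theta>_def field_simps)
  then have sin: "sin \<theta> \<noteq> 0" using sin_gt_zero[of \<theta>] by simp
  have gst: "gram s t = 2 * cos \<theta>" "gram t s = 2 * cos \<theta>"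
    using assms gram_sym[of s t] by (auto simp: gram_def \<theta>_def)
  have D: "4 * sin \<theta> * sin \<theta> \<noteq> 0" using sin by simp
  have D_eq: "4 * sin \<theta> * sin \<theta> = 4 - (2 * cos \<theta>) * (2 * cos \<theta>)"
    using sin_cos_squared_add3[of \<theta>] by algebra
  \<comment> \<open>\<open>a u\<close> and \<open>b u\<close> are chosen so that both reflections
    fix \<open>\<phi> u + a u * \<phi> s + b u * \<phi> t\<close>; this is the linear system
    \<open>ab\<close>, of determinant \<open>4 * sin \<theta> * sin \<theta>\<close>.\<close>
  define a where "a u = (2 * gram s u + 2 * cos \<theta> * gram t u) / (4 * sin \<theta> * sin \<theta>)" for u
  define b where "b u = (2 * gram t u + 2 * cos \<theta> * gram s u) / (4 * sin \<theta> * sin \<theta>)" for u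
  have lin: "x = 2 * p - q * c"
    if "p = (2 * x + c * y) / d" "q = (2 * y + c * x) / d" "d = 4 - c * c" "d \<noteq> 0"
    for p q x y c d :: real
  proof -
    have "p * d = 2 * x + c * y" "q * d = 2 * y + c * x" using that by simp_all
    then have "d * x = d * (2 * p - q * c)" using that(3) by algebra
    then show ?thesis using that(4) by simp
  qed
  have ab: "gram s u = 2 * a u - b u * (2 * cos \<theta>)" "gram t u = 2 * b u - a u * (2 * cos \<theta>)" for u
    using lin[OF a_def b_def D_eq D] lin[OF b_def a_def D_eq D] by auto
  \<comment> \<open>Polar coordinates of the pair of values at \<open>s\<close> and
    \<open>t\<close>; the cosine part is what
    \<open>\<phi> t = - R * sin (\<psi> + \<theta>)\<close> forces.\<close>
  obtain R \<psi> where R: "(- \<phi> t - \<phi> s * cos \<theta>) / sin \<theta> = R * cos \<psi>" "\<phi> s = R * sin \<psi>"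
    using polar_Ex by blast
  define P where "P \<psi> u = (if u = s then R * sin \<psi> else if u = t then - R * sin (\<psi> + \<theta>)
    else \<phi> u + a u * (\<phi> s - R * sin \<psi>) + b u * (\<phi> t + R * sin (\<psi> + \<theta>)))" for \<psi> u
  have \<phi>t: "\<phi> t = - R * sin (\<psi> + \<theta>)"
    using R(1) sin unfolding sin_add by (simp add: R(2) field_simps)
  have "\<phi> = P \<psi>"
    using R(2) \<phi>t by (auto simp: P_def)
  moreover have rs: "reflect s (P \<psi>) = P (- \<psi>)" for \<psi>
  proof
    fix u
    have e: "sin (\<psi> + \<theta>) = sin \<psi> * cos \<theta> + cos \<psi> * sin \<theta>"
      "sin (\<theta> - \<psi>) = - sin \<psi> * cos \<theta> + cos \<psi> * sin \<theta>"
      using sin_add[of \<psi> \<theta>] sin_diff[of \<theta> \<psi>] by auto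
    show "reflect s (P \<psi>) u = P (- \<psi>) u"
    proof (cases "u = s \<or> u = t")
      case True
      then show ?thesis using assms(1) by (auto simp: reflect_def P_def e gst algebra_simps)
    next
      case False
      then show ?thesis by (simp add: reflect_def P_def e ab(1)[of u] algebra_simps)
    qed
  qed
  moreover have rt: "reflect t (P \<psi>) = P (- \<psi> - 2 * \<theta>)" for \<psi>
  proof
    fix u
    define \<chi> where "\<chi> = \<psi> + \<theta>"
    have e: "sin (- \<psi> - \<theta> * 2) = - sin \<chi> * cos \<theta> - cos \<chi> * sin \<theta>"
      "sin (- \<psi> - \<theta>) = - sin \<chi>" "sin \<psi> = sin \<chi> * cos \<theta> - cos \<chi> * sin \<theta>"
      "sin (\<psi> + \<theta>) = sin \<chi>"
      using sin_minus[of "\<chi> + \<theta>"] sin_add[of \<chi> \<theta>] sin_minus[of \<chi>] sin_diff[of \<chi> \<theta>]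
      by (auto simp: \<chi>_def algebra_simps)
    show "reflect t (P \<psi>) u = P (- \<psi> - 2 * \<theta>) u"
    proof (cases "u = s \<or> u = t")
      case True
      then show ?thesis using assms(1) by (auto simp: reflect_def P_def e gst algebra_simps)
    next
      case False
      then show ?thesis
        using assms(1) by (simp add: reflect_def P_def e ab(2)[of u] algebra_simps)
    qed
  qed
  moreover have "fold reflect (alternating s t (2 * n)) (P \<psi>) = P (\<psi> - 2 * n * (pi / k))" for \<psi> n
  proof (induction n arbitrary: \<psi>)
    case (Suc n)
    have "alternating s t (2 * Suc n) = s # t # alternating s t (2 * n)" by simp
    then show ?case
      using Suc by (simp add: rs rt algebra_simps \<theta>_def add_divide_distrib)
  qed simp
  moreover have "P (\<psi> - 2 * pi) = P \<psi>" for \<psi>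
    using sin_periodic[of "\<psi> - 2 * pi"] sin_periodic[of "\<psi> - 2 * pi + \<theta>"]
    by (simp add: P_def fun_eq_iff algebra_simps)
  ultimately show ?thesis
    using that[of P \<psi> R] assms(1) by (simp add: P_def \<theta>_def)
qed

text \<open>After \<open>k\<close> double steps the angle has moved by
  \<open>2 * pi\<close>.\<close>

lemma reflect_braid:
  assumes "s \<noteq> t" "m s t = enat k"
  shows "fold reflect (alternating s t k) \<phi> = fold reflect (alternating t s k) \<phi>"
proof (rule fold_braidI)
  fix \<phi>
  have k: "2 \<le> k" using two_le assms by simp
  from assms obtain P \<psi> R where P: "\<phi> = P \<psi>"
    "\<And>\<psi> n. fold reflect (alternating s t (2 * n)) (P \<psi>) = P (\<psi> - 2 * n * (pi / k))"
    "\<And>\<psi>. P (\<psi> - 2 * pi) = P \<psi>"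
    by (rule reflect_alternating[where \<phi> = \<phi>]) blast
  show "fold reflect (alternating s t (2 * k)) \<phi> = \<phi>"
    using P(2)[of k \<psi>] P(3)[of \<psi>] k by (simp add: P(1))
qed simp

lemma fold_reflect_ev: "ev xs = ev ys \<Longrightarrow> fold reflect xs \<phi> = fold reflect ys \<phi>"
  by (rule fold_eqI) (auto intro: reflect_braid)

text \<open>The braid relation kills the multiples of \<open>k\<close>. That nothing else dies is
  read off the linear action: a double step rotates by \<open>2 * pi / k\<close> if
  \<open>m s t\<close> is finite, and otherwise translates the value at \<open>s\<close>.\<close>

lemma ev_alternating_double_eq_0:
  assumes "s \<noteq> t"
  shows "ev (alternating s t (2 * n)) = 0 \<longleftrightarrow> (case m s t of enat k \<Rightarrow> k dvd n | \<infinity> \<Rightarrow> n = 0)"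
proof (cases "m s t")
  case (enat k)
  have k: "2 \<le> k" using two_le assms enat by simp
  have "ev (alternating s t (2 * k)) = 0"
    using braid[OF assms enat] by (simp add: alternating_double ev_rev)
  then have mult: "ev (alternating s t (2 * (k * j))) = 0" for j
  proof (induction j)
    case (Suc j)
    have "2 * (k * Suc j) = 2 * k + 2 * (k * j)" by simp
    then show ?case using Suc \<open>ev (alternating s t (2 * k)) = 0\<close> by (simp only: alternating_add) simp
  qed simp
  have "k dvd n" if "ev (alternating s t (2 * n)) = 0"
  proof -
    define \<theta> where "\<theta> = pi / k"
    have "0 < \<theta>" "\<theta> < pi" using k by (auto simp: \<theta>_def field_simps)
    then have sin: "sin \<theta> \<noteq> 0" using sin_gt_zero[of \<theta>] by simp
    \<comment> \<open>These values force \<open>sin \<psi> = 0\<close> and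
      \<open>R * cos \<psi> = 1\<close>, so the form is moved by every rotation that is not a full
      turn.\<close>
    define \<phi> where "\<phi> u = (if u = s then 0 else if u = t then - sin \<theta> else 0)" for u
    from assms enat obtain P \<psi> R where P: "\<phi> = P \<psi>"
      "\<And>\<psi> n. fold reflect (alternating s t (2 * n)) (P \<psi>) = P (\<psi> - 2 * n * (pi / k))"
      "\<And>\<psi>. P \<psi> s = R * sin \<psi>" "\<And>\<psi>. P \<psi> t = - R * sin (\<psi> + pi / k)"
      by (rule reflect_alternating[where \<phi> = \<phi>]) blast
    have "R * sin \<psi> = 0" "R * sin (\<psi> + \<theta>) = sin \<theta>"
      using P(3,4)[of \<psi>] assms fun_cong[OF P(1), of s] fun_cong[OF P(1), of t]
      by (auto simp: \<phi>_def \<theta>_def)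
    then have \<psi>: "R \<noteq> 0" "sin \<psi> = 0" "R * cos \<psi> = 1"
      using sin by (auto simp: sin_add)
    define \<omega> where "\<omega> = 2 * n * \<theta>"
    have eq: "P (\<psi> - \<omega>) = P \<psi>"
      using fold_reflect_ev[of "alternating s t (2 * n)" "[]" "P \<psi>"] that P(2)
      by (simp add: \<omega>_def \<theta>_def)
    have "sin (\<psi> - \<omega>) = 0" "R * sin (\<psi> - \<omega> + \<theta>) = sin \<theta>"
      using P(3,4)[of "\<psi> - \<omega>"] P(3,4)[of \<psi>] \<psi> \<open>R * sin (\<psi> + \<theta>) = sin \<theta>\<close>
      unfolding eq by (simp_all add: \<theta>_def)
    then have "R * cos (\<psi> - \<omega>) = 1"
      using sin by (simp add: sin_add)
    then have "cos \<omega> = 1"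
      using \<psi> by (simp add: cos_diff) (metis mult.assoc mult_1)
    then obtain j :: int where "\<omega> = of_int j * 2 * pi"
      using cos_one_2pi_int by auto
    then have "real n = of_int (j * int k)"
      using k by (simp add: \<omega>_def \<theta>_def field_simps)
    then have "int n = j * int k"
      by linarith
    then show "k dvd n"
      by (metis dvd_triv_right int_dvd_int_iff)
  qed
  then show ?thesis
    using mult enat by (auto elim!: dvdE)
next
  case infinity
  \<comment> \<open>With \<open>gram s t = 2\<close> the sum of the values at \<open>s\<close> and
    \<open>t\<close> is invariant. Normalized to 1, it makes each double step add 2 to the value at
    \<open>s\<close>.\<close>
  define P where "P x u = (if u = s then x else if u = t then 1 - x else 0)" for x :: real and u
  have g: "gram s t = 2" "gram t s = 2"
    using infinity sym[of s t] by (auto simp: gram_def)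
  have st: "fold reflect (alternating s t (2 * n)) \<phi> s = x + 2 * n"
    if "\<phi> s = x" "\<phi> t = 1 - x" for x n \<phi>
    using that
  proof (induction n arbitrary: x \<phi>)
    case (Suc n)
    have "alternating s t (2 * Suc n) = s # t # alternating s t (2 * n)" by simp
    moreover have "fold reflect (alternating s t (2 * n)) (reflect t (reflect s \<phi>)) s = (x + 2) + 2 * n"
      using Suc(2,3) assms by (intro Suc.IH) (auto simp: reflect_def g)
    ultimately show ?case by simp
  qed simp
  have "n = 0" if "ev (alternating s t (2 * n)) = 0"
    using fold_reflect_ev[of "alternating s t (2 * n)" "[]" "P 0"] st[of "P 0" 0 n] that assms
    by (simp add: P_def)
  then show ?thesis
    using infinity by auto
qed

lemma r_inject: "r s = r t \<longleftrightarrow> s = t"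
proof
  assume "r s = r t"
  show "s = t"
  proof (rule ccontr)
    assume "s \<noteq> t"
    moreover have "alternating s t (2 * 1) = [s, t]" by (simp add: numeral_2_eq_2)
    then have "ev (alternating s t (2 * 1)) = 0" using \<open>r s = r t\<close> by simp
    ultimately have "case m s t of enat k \<Rightarrow> k dvd 1 | \<infinity> \<Rightarrow> (1::nat) = 0"
      using ev_alternating_double_eq_0 by blast
    then show False
      using two_le[OF \<open>s \<noteq> t\<close>] by (auto split: enat.splits)
  qed
qed simp

end

section \<open>Inversions and parabolic subgroups of Coxeter groups\<close>

lemmas group_word_simps = diff_conv_add_uminus minus_add add.assoc

context coxeter_system
begin

definition parabolic :: "'a set \<Rightarrow> 'w set" where
  "parabolic X = ev ` lists X"

abbreviation W :: "'w set" where
  "W \<equiv> parabolic UNIV"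

lemma ev_in_parabolic: "xs \<in> lists X \<Longrightarrow> ev xs \<in> parabolic X"
  by (simp add: parabolic_def)

lemma ev_in_W [simp]: "ev xs \<in> W"
  by (simp add: parabolic_def)

lemma zero_in_parabolic [simp]: "0 \<in> parabolic X"
  using ev_in_parabolic[of "[]" X] by simp

lemma r_in_parabolic: "s \<in> X \<Longrightarrow> r s \<in> parabolic X"
  using ev_in_parabolic[of "[s]" X] by simp

lemma parabolic_add: "u \<in> parabolic X \<Longrightarrow> v \<in> parabolic X \<Longrightarrow> u + v \<in> parabolic X"
  unfolding parabolic_def by (force simp flip: ev_simps(3))

lemma parabolic_uminus: "u \<in> parabolic X \<Longrightarrow> - u \<in> parabolic X"
  unfolding parabolic_def by (force simp flip: ev_rev)

lemma parabolic_diff: "u \<in> parabolic X \<Longrightarrow> v \<in> parabolic X \<Longrightarrow> u - v \<in> parabolic X"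
  using parabolic_add[OF _ parabolic_uminus, of u X v] by simp

lemma parabolic_mono: "X \<subseteq> Y \<Longrightarrow> parabolic X \<subseteq> parabolic Y"
  unfolding parabolic_def by (intro image_mono lists_mono)

lemma parabolic_subset_W: "u \<in> parabolic X \<Longrightarrow> u \<in> W"
  using parabolic_mono[of X UNIV] by auto

lemma r_in_W [simp]: "r s \<in> W"
  by (simp add: r_in_parabolic)

lemmas W_closed = parabolic_add[of _ UNIV] parabolic_uminus[of _ UNIV] parabolic_diff[of _ UNIV]
  parabolic_subset_W

text \<open>For a word \<open>s_1 ... s_n\<close> these are the elements
  \<open>s_1 ... s_(i-1) s_i s_(i-1) ... s_1\<close>; adding the \<open>i\<close>-th one on the left
  deletes the \<open>i\<close>-th letter.\<close>

fun reflections :: "'a list \<Rightarrow> 'w list" where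
  "reflections [] = []"
| "reflections (s # xs) = r s # map (\<lambda>t. r s + t - r s) (reflections xs)"

lemma conj_add: "(u + v) + t - (u + v) = u + (v + t - v) - u" for u v t :: 'w
  by (simp add: group_word_simps del: add_uminus_conv_diff)

lemma reflections_append:
  "reflections (xs @ ys) = reflections xs @ map (\<lambda>t. ev xs + t - ev xs) (reflections ys)"
  by (induction xs) (auto simp: conj_add)

lemma in_reflectionsE:
  assumes "t \<in> set (reflections xs)"
  obtains ys s zs where "xs = ys @ s # zs" "t = ev ys + r s - ev ys" "t + ev xs = ev (ys @ zs)"
proof -
  have "\<exists>ys s zs. xs = ys @ s # zs \<and> t = ev ys + r s - ev ys"
    using assms
  proof (induction xs arbitrary: t)
    case (Cons x xs)
    show ?case
    proof (cases "t = r x")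
      case True
      then show ?thesis by (intro exI[of _ "[]"]) auto
    next
      case False
      then obtain t' where t': "t' \<in> set (reflections xs)" "t = r x + t' - r x"
        using Cons.prems by auto
      then obtain ys s zs where "xs = ys @ s # zs" "t' = ev ys + r s - ev ys"
        using Cons.IH by blast
      then show ?thesis
        using t' conj_add by (intro exI[of _ "x # ys"]) auto
    qed
  qed auto
  then obtain ys s zs where "xs = ys @ s # zs" "t = ev ys + r s - ev ys" by blast
  moreover from this have "t + ev xs = ev (ys @ zs)" by (simp flip: add.assoc)
  ultimately show ?thesis using that by blast
qed

lemma reflections_alternating:
  "reflections (alternating s t k) = map (\<lambda>i. ev (alternating s t (2 * i + 1))) [0..<k]"
proof (induction k arbitrary: s t)
  case (Suc k)
  have step: "r s + ev (alternating t s (2 * i + 1)) - r s = ev (alternating s t (2 * Suc i + 1))" for i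
  proof -
    have "alternating s t (2 * Suc i + 1) = s # alternating t s (2 * i + 1) @ [s]"
      using alternating_Suc_right[of t s "2 * i + 1"] by simp
    then show ?thesis by (simp add: diff_r add.assoc del: alternating.simps)
  qed
  have "reflections (alternating s t (Suc k)) =
      r s # map (\<lambda>i. r s + ev (alternating t s (2 * i + 1)) - r s) [0..<k]"
    using Suc by simp
  also have "\<dots> = r s # map (\<lambda>i. ev (alternating s t (2 * Suc i + 1))) [0..<k]"
    by (simp only: step)
  also have "\<dots> = map (\<lambda>i. ev (alternating s t (2 * i + 1))) (0 # map Suc [0..<k])"
    by simp
  also have "0 # map Suc [0..<k] = [0..<Suc k]"
    using upt_conv_Cons[of 0 "Suc k"] by (simp add: map_Suc_upt del: upt_Suc)
  finally show ?case .
qed simp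

lemma ev_alternating_odd:
  assumes "ev (alternating s t (2 * k)) = 0" "odd p" "odd q" "p + q = 2 * k"
  shows "ev (alternating s t p) = ev (alternating t s q)"
proof -
  have "ev (alternating s t p) + ev (alternating t s q) = 0"
    using alternating_add[of s t p q] assms by (simp flip: ev_simps(3))
  then have "ev (alternating s t p) = - ev (alternating t s q)"
    by (simp add: eq_neg_iff_add_eq_0)
  then show ?thesis
    using assms(3) by (simp flip: ev_rev add: rev_alternating)
qed

text \<open>Palindromes with different first letters whose lengths add up to \<open>2 * k\<close>
  are mutually inverse, hence equal. So both sides of a braid relation meet every reflection equally
  often.\<close>

lemma reflections_alternating_rev:
  assumes "ev (alternating s t k) = ev (alternating t s k)"
  shows "reflections (alternating t s k) = rev (reflections (alternating s t k))"
proof (rule nth_equalityI)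
  fix i assume "i < length (reflections (alternating t s k))"
  then have i: "i < k" by (simp add: reflections_alternating)
  have "ev (alternating s t (2 * k)) = 0"
    using assms by (simp add: alternating_double ev_rev)
  then have "ev (alternating s t (2 * (k - Suc i) + 1)) = ev (alternating t s (2 * i + 1))"
    by (rule ev_alternating_odd) (use i in auto)
  then show "reflections (alternating t s k) ! i = rev (reflections (alternating s t k)) ! i"
    using i by (simp add: reflections_alternating rev_nth del: alternating.simps)
qed (simp add: reflections_alternating)

text \<open>The classical action behind the exchange condition: the predicate is a set of
  reflections, and a step from \<open>u\<close> to \<open>u + r s\<close> switches membership of the
  reflection that exchanges these two elements.\<close>

definition toggle :: "'a \<Rightarrow> 'w \<times> ('w \<Rightarrow> bool) \<Rightarrow> 'w \<times> ('w \<Rightarrow> bool)" where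
  "toggle s = (\<lambda>(u, P). (u + r s, \<lambda>t. P t \<noteq> (t = u + r s - u)))"

lemma fold_toggle:
  "fold toggle xs (u, P) =
    (u + ev xs, \<lambda>t. P t \<noteq> odd (count_list (reflections xs) (- u + t + u)))"
proof (induction xs arbitrary: u P)
  case (Cons s xs)
  have cnt: "count_list (reflections (s # xs)) (- u + t + u) =
      (if t = u + r s - u then 1 else 0) + count_list (reflections xs) (- (u + r s) + t + (u + r s))" for t
  proof -
    have "- (u + r s) + t + (u + r s) = - r s + (- u + t + u) + r s"
      by (simp add: group_word_simps del: add_uminus_conv_diff)
    moreover have "t = u + r s - u \<longleftrightarrow> r s = - u + t + u"
      using conj_eq_iff[of u "r s" t] by auto
    ultimately show ?thesis
      by (auto simp only: reflections.simps count_list.simps count_list_conj split: if_splits)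
  qed
  have "fold toggle (s # xs) (u, P) = fold toggle xs (u + r s, \<lambda>t. P t \<noteq> (t = u + r s - u))"
    by (simp add: toggle_def)
  then show ?case
    unfolding Cons.IH cnt by (auto simp: add.assoc)
qed simp

lemma odd_count_reflections_eqI:
  assumes "ev xs = ev ys"
  shows "odd (count_list (reflections xs) t) = odd (count_list (reflections ys) t)"
proof -
  have "fold toggle xs (0, \<lambda>_. False) = fold toggle ys (0, \<lambda>_. False)"
  proof (rule fold_eqI[OF assms])
    fix s and x :: "'w \<times> ('w \<Rightarrow> bool)"
    obtain u P where x: "x = (u, P)" by (cases x)
    have "u + r s + r s - (u + r s) = u + r s - u"
      by (simp add: group_word_simps del: add_uminus_conv_diff)
    then show "toggle s (toggle s x) = x"
      by (auto simp: toggle_def x fun_eq_iff add.assoc)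
  next
    fix s t k and x :: "'w \<times> ('w \<Rightarrow> bool)"
    assume "s \<noteq> t" "m s t = enat k"
    then have "ev (alternating s t k) = ev (alternating t s k)" by (rule braid)
    then show "fold toggle (alternating s t k) x = fold toggle (alternating t s k) x"
      by (cases x) (simp add: fold_toggle reflections_alternating_rev[of s t k] count_list_rev)
  qed
  then show ?thesis
    by (simp add: fold_toggle fun_eq_iff)
qed

text \<open>
  For a reflection \<open>t\<close> this means that \<open>t + w\<close> is shorter than \<open>w\<close>. The parity, unlike the number of
  occurrences, does not depend on the word chosen for \<open>w\<close>.
\<close>

definition inversion :: "'w \<Rightarrow> 'w \<Rightarrow> bool" where
  "inversion w t \<longleftrightarrow> odd (count_list (reflections (SOME xs. ev xs = w)) t)"

lemma inversion_ev: "inversion (ev xs) t \<longleftrightarrow> odd (count_list (reflections xs) t)"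
  unfolding inversion_def by (rule odd_count_reflections_eqI) (rule someI[of _ xs], simp)

lemma W_E: assumes "w \<in> W" obtains xs where "w = ev xs"
  using assms by (auto simp: parabolic_def)

text \<open>Cocycle rule: a concatenated word has the reflections of \<open>u\<close>, followed by
  the conjugates by \<open>u\<close> of those of \<open>v\<close>, and occurrences add modulo
  two.\<close>

lemma inversion_add:
  assumes "u \<in> W" "v \<in> W"
  shows "inversion (u + v) t \<longleftrightarrow> inversion u t \<noteq> inversion v (- u + t + u)"
proof -
  obtain xs ys where "u = ev xs" "v = ev ys"
    using assms by (elim W_E)
  then show ?thesis
    using inversion_ev[of "xs @ ys" t]
    by (simp add: inversion_ev reflections_append count_list_conj)
qed

lemma inversion_0 [simp]: "\<not> inversion 0 t"
  using inversion_ev[of "[]" t] by simp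

lemma inversion_r [simp]: "inversion (r s) t \<longleftrightarrow> t = r s"
  using inversion_ev[of "[s]" t] by auto

definition reflection :: "'w \<Rightarrow> bool" where
  "reflection t \<longleftrightarrow> (\<exists>u\<in>W. \<exists>s. t = u + r s - u)"

lemma reflection_r [simp]: "reflection (r s)"
  unfolding reflection_def by (rule bexI[of _ 0]) auto

lemma reflection_conj: "u \<in> W \<Longrightarrow> reflection t \<Longrightarrow> reflection (u + t - u)"
  unfolding reflection_def by (metis conj_add W_closed(1))

lemma reflection_in_W: "reflection t \<Longrightarrow> t \<in> W"
  unfolding reflection_def by (auto intro!: W_closed(1,3))

text \<open>Expand \<open>u + r s - u\<close> by the cocycle rule. The contributions of
  \<open>u\<close> and \<open>- u\<close> cancel, since \<open>u + - u = 0\<close> has no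
  inversions, and the one of \<open>r s\<close> remains.\<close>

lemma inversion_self:
  assumes "reflection t"
  shows "inversion t t"
proof -
  obtain u s where u: "u \<in> W" "t = u + r s - u"
    using assms by (auto simp: reflection_def)
  have "- (u + r s) + t + (u + r s) = r s" "- u + t + u = r s"
    by (simp_all add: u group_word_simps del: add_uminus_conv_diff)
  then have "inversion ((u + r s) + - u) t \<longleftrightarrow> (inversion u t \<noteq> True) \<noteq> inversion (- u) (r s)"
    using u by (subst inversion_add) (auto simp: W_closed inversion_add)
  moreover have "inversion (u + - u) t \<longleftrightarrow> inversion u t \<noteq> inversion (- u) (r s)"
    using u(1) \<open>- u + t + u = r s\<close> by (subst inversion_add) (auto simp: W_closed)
  ultimately show ?thesis
    by (simp add: u(2))
qed

lemma reflection_add_self: "reflection t \<Longrightarrow> t + t = 0"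
  by (auto simp: reflection_def group_word_simps simp del: add_uminus_conv_diff)

section \<open>Length, exchange and shortest coset representatives\<close>

definition len :: "'w \<Rightarrow> nat" where
  "len w = (LEAST n. \<exists>xs. ev xs = w \<and> length xs = n)"

lemma len_ev_le: "len (ev xs) \<le> length xs"
  unfolding len_def by (rule Least_le) auto

lemma reducedE:
  assumes "w \<in> W"
  obtains xs where "ev xs = w" "length xs = len w"
proof -
  obtain xs where "w = ev xs" using assms by (rule W_E)
  then have "\<exists>ys. ev ys = w \<and> length ys = len w"
    unfolding len_def by (intro LeastI[where P = "\<lambda>n. \<exists>xs. ev xs = w \<and> length xs = n"]) auto
  then show ?thesis using that by blast
qed

lemma len_0 [simp]: "len 0 = 0"
  using len_ev_le[of "[]"] by simp

lemma len_uminus: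
  assumes "w \<in> W"
  shows "len (- w) = len w"
proof -
  have le: "len (- u) \<le> len u" if "u \<in> W" for u
    using that len_ev_le by (metis reducedE ev_rev length_rev)
  show ?thesis
    using le[of w] le[of "- w"] assms by (simp add: W_closed(2))
qed

lemma len_add_le: "u \<in> W \<Longrightarrow> v \<in> W \<Longrightarrow> len (u + v) \<le> len u + len v"
  by (metis reducedE ev_simps(3) len_ev_le length_append)

lemma len_r_le: "len (r s) \<le> 1"
  using len_ev_le[of "[s]"] by simp

lemma len_r_add_le: "w \<in> W \<Longrightarrow> len (r s + w) \<le> Suc (len w)"
  using len_add_le[of "r s" w] len_r_le[of s] by simp

lemma len_le_r_add: "w \<in> W \<Longrightarrow> len w \<le> Suc (len (r s + w))"
  using len_r_add_le[of "r s + w" s] by (simp add: W_closed)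

lemma exchange:
  assumes "inversion (ev xs) t"
  obtains ys s zs where "xs = ys @ s # zs" "t = ev ys + r s - ev ys" "t + ev xs = ev (ys @ zs)"
proof -
  have "t \<in> set (reflections xs)"
    using assms count_notin by (fastforce simp: inversion_ev)
  then show ?thesis using that by (rule in_reflectionsE)
qed

lemma len_less_if_inversion:
  assumes "w \<in> W" "inversion w t"
  shows "len (t + w) < len w"
proof -
  obtain xs where xs: "ev xs = w" "length xs = len w" using assms(1) by (rule reducedE)
  obtain ys s zs where "xs = ys @ s # zs" "t + ev xs = ev (ys @ zs)"
    using exchange assms(2) xs(1) by metis
  then show ?thesis using len_ev_le[of "ys @ zs"] xs by simp
qed

text \<open>By the cocycle rule exactly one of \<open>w\<close> and \<open>t + w\<close> has the
  inversion \<open>t\<close>, and that one is the longer.\<close>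

lemma inversion_iff_less:
  assumes "w \<in> W" "reflection t"
  shows "inversion w t \<longleftrightarrow> len (t + w) < len w" "\<not> inversion w t \<longleftrightarrow> len w < len (t + w)"
proof -
  have t: "t \<in> W" "t + (t + w) = w"
    using assms reflection_in_W reflection_add_self by (simp_all flip: add.assoc)
  have "inversion (t + w) t \<longleftrightarrow> \<not> inversion w t"
    using inversion_add[OF t(1) assms(1), of t] inversion_self[OF assms(2)]
    by (simp add: add.assoc reflection_add_self[OF assms(2)])
  then have "len w < len (t + w)" if "\<not> inversion w t"
    using len_less_if_inversion[of "t + w" t] that t assms by (simp add: W_closed)
  moreover have "len (t + w) < len w" if "inversion w t"
    using len_less_if_inversion assms that by blast
  ultimately show "inversion w t \<longleftrightarrow> len (t + w) < len w" "\<not> inversion w t \<longleftrightarrow> len w < len (t + w)"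
    by fastforce+
qed

text \<open>Prefixing a letter to a reduced word keeps it reduced or, by exchange, amounts to
  deleting one of its letters; no letter outside \<open>X\<close> ever enters.\<close>

lemma parabolic_reducedE:
  assumes "v \<in> parabolic X"
  obtains xs where "xs \<in> lists X" "ev xs = v" "length xs = len v"
proof -
  have "\<exists>ys\<in>lists X. ev ys = ev xs \<and> length ys = len (ev xs)" if "xs \<in> lists X" for xs
    using that
  proof (induction xs rule: list.induct)
    case (Cons x xs)
    then obtain ys where ys: "ys \<in> lists X" "ev ys = ev xs" "length ys = len (ev xs)" by auto
    show ?case
    proof (cases "inversion (ev ys) (r x)")
      case True
      then obtain as s bs where "ys = as @ s # bs" "r x + ev ys = ev (as @ bs)"
        by (rule exchange)
      moreover from this have "length (as @ bs) = len (ev (x # xs))"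
        using ys len_ev_le[of "as @ bs"] len_le_r_add[of "ev ys" x] by auto
      ultimately show ?thesis
        using ys by (intro bexI[of _ "as @ bs"]) auto
    next
      case False
      then have "len (ev ys) < len (r x + ev ys)"
        by (simp add: inversion_iff_less(2))
      then show ?thesis
        using ys Cons.prems len_r_add_le[of "ev ys" x] by (intro bexI[of _ "x # ys"]) auto
    qed
  qed (auto intro: bexI[of _ "[]"])
  then show ?thesis
    using assms that by (auto simp: parabolic_def)
qed

lemma r_neq_0 [simp]: "r s \<noteq> 0"
proof
  have "inversion (r s) (r s)" by simp
  moreover assume "r s = 0"
  ultimately show False using inversion_0[of "r s"] by metis
qed

lemma r_in_parabolic_iff [simp]: "r s \<in> parabolic X \<longleftrightarrow> s \<in> X"
proof
  assume "r s \<in> parabolic X"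
  then obtain xs where xs: "xs \<in> lists X" "ev xs = r s" "length xs = len (r s)"
    by (rule parabolic_reducedE)
  then have "length xs \<le> 1" using len_r_le by simp
  then show "s \<in> X"
    using xs by (cases xs) (auto simp: r_inject)
qed (rule r_in_parabolic)

lemma len_eq_1E:
  assumes "v \<in> parabolic X" "len v \<le> 1" "v \<noteq> 0"
  obtains x where "x \<in> X" "v = r x"
proof -
  obtain xs where xs: "xs \<in> lists X" "ev xs = v" "length xs = len v"
    using assms(1) by (rule parabolic_reducedE)
  then have "length xs \<le> 1" using assms(2) by simp
  then show ?thesis using assms(3) that xs(1,2) by (cases xs) auto
qed

text \<open>Take a reduced word in \<open>X\<close>. Its first letter \<open>x\<close> gives an
  inversion, so exchange in a word in \<open>Y\<close> for the same element puts the tail into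
  \<open>parabolic Y\<close>. Then \<open>r x\<close> lies there too, which forces
  \<open>x \<in> Y\<close>.\<close>

lemma parabolic_Int: "parabolic X \<inter> parabolic Y = parabolic (X \<inter> Y)"
proof
  have "ev xs \<in> parabolic (X \<inter> Y)"
    if "xs \<in> lists X" "length xs = len (ev xs)" "ev xs \<in> parabolic Y" for xs
    using that
  proof (induction xs rule: list.induct)
    case (Cons x xs)
    have red: "length xs = len (ev xs)"
      using Cons.prems(2) len_ev_le[of xs] len_r_add_le[of "ev xs" x] by simp
    obtain ys where ys: "ys \<in> lists Y" "ev ys = ev (x # xs)"
      using Cons.prems(3) unfolding parabolic_def by (metis imageE)
    have "len (r x + ev (x # xs)) < len (ev (x # xs))"
      using Cons.prems(2) red by simp
    then have "inversion (ev ys) (r x)"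
      using inversion_iff_less(1)[OF ev_in_W reflection_r, of "x # xs" x] ys(2) by simp
    then obtain as s bs where *: "ys = as @ s # bs" "r x + ev ys = ev (as @ bs)"
      by (rule exchange)
    then have xs: "ev xs \<in> parabolic Y"
      using ys by (simp flip: ev_simps(3) add: ev_in_parabolic)
    then have "ev (x # xs) - ev xs \<in> parabolic Y"
      using Cons.prems(3) parabolic_diff by blast
    then have "x \<in> X \<inter> Y"
      using Cons.prems(1) by simp
    moreover have "ev xs \<in> parabolic (X \<inter> Y)"
      using Cons.IH Cons.prems(1) red xs by simp
    ultimately show ?case
      using parabolic_add[OF r_in_parabolic] by simp
  qed simp
  note reduced = this
  show "parabolic X \<inter> parabolic Y \<subseteq> parabolic (X \<inter> Y)"
  proof
    fix v assume v: "v \<in> parabolic X \<inter> parabolic Y"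
    then have "v \<in> parabolic X" by simp
    then obtain xs where "xs \<in> lists X" "ev xs = v" "length xs = len v"
      by (rule parabolic_reducedE)
    then show "v \<in> parabolic (X \<inter> Y)" using reduced[of xs] v by blast
  qed
  show "parabolic (X \<inter> Y) \<subseteq> parabolic X \<inter> parabolic Y"
    using parabolic_mono[of "X \<inter> Y"] by auto
qed

text \<open>\<open>w0\<close> is a shortest element of its coset. If lengths failed to add along a
  reduced word in \<open>X\<close>, the cocycle rule would give an element of
  \<open>parabolic X\<close> that shortens \<open>w0\<close>.\<close>

lemma parabolic_decomposition_left:
  assumes "w \<in> W"
  obtains d w0 where "d \<in> parabolic X" "w0 \<in> W" "w = d + w0"
    "\<And>v. v \<in> parabolic X \<Longrightarrow> len (v + w0) = len v + len w0"
proof -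
  obtain d where d: "d \<in> parabolic X"
    and min: "\<And>v. v \<in> parabolic X \<Longrightarrow> len (d + w) \<le> len (v + w)"
    using ex_has_least_nat[of "\<lambda>v. v \<in> parabolic X" 0 "\<lambda>v. len (v + w)"] zero_in_parabolic by blast
  define w0 where "w0 = d + w"
  have w0: "w0 \<in> W" using d assms by (simp add: w0_def W_closed)
  have "len (ev xs + w0) = length xs + len w0" if "xs \<in> lists X" "length xs = len (ev xs)" for xs
    using that
  proof (induction xs rule: list.induct)
    case (Cons x xs)
    have red: "length xs = len (ev xs)"
      using Cons.prems(2) len_ev_le[of xs] len_r_add_le[of "ev xs" x] by simp
    have IH: "len (ev xs + w0) = length xs + len w0" using Cons red by simp
    define t where "t = - ev xs + r x + ev xs"
    have t: "t \<in> parabolic X"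
      unfolding t_def using Cons.prems(1)
      by (intro parabolic_add parabolic_uminus ev_in_parabolic r_in_parabolic) auto
    have "len (ev xs) < len (r x + ev xs)"
      using Cons.prems(2) red by simp
    then have "\<not> inversion (ev xs) (r x)"
      by (simp add: inversion_iff_less(2))
    moreover have "\<not> inversion w0 t"
    proof
      assume "inversion w0 t"
      then have "len (t + w0) < len w0" using w0 len_less_if_inversion by blast
      then show False using min[OF parabolic_add[OF t d]] by (simp add: w0_def add.assoc)
    qed
    ultimately have "\<not> inversion (ev xs + w0) (r x)"
      using w0 by (simp add: inversion_add t_def)
    then have "len (ev xs + w0) < len (r x + (ev xs + w0))"
      using w0 by (simp add: inversion_iff_less(2) W_closed)
    then show ?case
      using IH len_r_add_le[of "ev xs + w0" x] w0 by (simp add: W_closed add.assoc)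
  qed simp
  note reduced = this
  have "len (v + w0) = len v + len w0" if v: "v \<in> parabolic X" for v
  proof -
    obtain xs where "xs \<in> lists X" "ev xs = v" "length xs = len v"
      using v by (rule parabolic_reducedE)
    then show ?thesis using reduced[of xs] by metis
  qed
  moreover have "w = - d + w0" by (simp add: w0_def)
  ultimately show ?thesis
    using that parabolic_uminus[OF d] w0 by blast
qed

lemma parabolic_decomposition:
  assumes "w \<in> W"
  obtains d w0 where "d \<in> parabolic X" "w0 \<in> W" "w = w0 + d"
    "\<And>v. v \<in> parabolic X \<Longrightarrow> len (w0 + v) = len w0 + len v"
proof -
  obtain d w0 where *: "d \<in> parabolic X" "w0 \<in> W" "- w = d + w0"
    "\<And>v. v \<in> parabolic X \<Longrightarrow> len (v + w0) = len v + len w0"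
    using assms by (rule parabolic_decomposition_left[OF W_closed(2), where X = X]) blast
  have "w = - w0 + - d"
    using arg_cong[OF *(3), of uminus] by (simp add: minus_add)
  moreover have "len (- w0 + v) = len (- w0) + len v" if "v \<in> parabolic X" for v
    using *(4)[OF parabolic_uminus[OF that]] len_uminus[of "- w0 + v"] len_uminus[of w0]
      len_uminus[of v] that *(2) by (simp add: minus_add W_closed)
  ultimately show ?thesis
    using that[of "- d" "- w0"] * by (simp add: parabolic_uminus)
qed

lemma inversion_decomposition:
  assumes "w0 \<in> W" "d \<in> W" "len (w0 + d) = len w0 + len d" "reflection t" "inversion w0 t"
  shows "inversion (w0 + d) t"
proof -
  have "len (t + w0) < len w0" using assms inversion_iff_less(1) by blast
  moreover have "len ((t + w0) + d) \<le> len (t + w0) + len d"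
    using assms reflection_in_W by (intro len_add_le) (auto intro: W_closed)
  ultimately show ?thesis
    using assms by (subst inversion_iff_less(1)) (auto simp: add.assoc W_closed)
qed

text \<open>A reflection is an inversion of itself, so it is among the reflections of any word in
  \<open>X\<close> for it.\<close>

lemma reflection_in_parabolicE:
  assumes "reflection t" "t \<in> parabolic X"
  obtains v x where "v \<in> parabolic X" "x \<in> X" "t = v + r x - v"
proof -
  obtain xs where xs: "xs \<in> lists X" "t = ev xs"
    using assms(2) by (auto simp: parabolic_def)
  have "inversion (ev xs) t" using inversion_self[OF assms(1)] xs by simp
  then obtain ys s zs where "xs = ys @ s # zs" "t = ev ys + r s - ev ys"
    by (rule exchange)
  then show ?thesis using that[of "ev ys" s] xs by (auto intro: ev_in_parabolic)
qed

end

section \<open>Roots\<close>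

definition group_order :: "'g::group_add \<Rightarrow> enat" where
  "group_order g = (if \<exists>n>0. sum_list (replicate n g) = 0
     then enat (LEAST n. n > 0 \<and> sum_list (replicate n g) = 0) else \<infinity>)"

lemma sum_list_replicate_conj:
  "sum_list (replicate n (w + g - w)) = w + sum_list (replicate n g) - w" for w g :: "'g::group_add"
  by (induction n) (simp_all add: group_word_simps del: add_uminus_conv_diff)

lemma group_order_conj: "group_order (w + g - w) = group_order g" for w g :: "'g::group_add"
proof -
  have "w + a - w = 0 \<longleftrightarrow> a = 0" for a
    using add_left_cancel[of w a 0] by (simp add: diff_eq_eq)
  then show ?thesis by (simp add: group_order_def sum_list_replicate_conj)
qed

context coxeter_system
begin

lemma group_order_r:
  assumes "s \<noteq> t"
  shows "group_order (r s + r t) = m s t"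
proof -
  have "ev (alternating s t (2 * n)) = sum_list (replicate n (r s + r t))" for n
    by (induction n) (auto simp: add.assoc)
  then have *: "sum_list (replicate n (r s + r t)) = 0 \<longleftrightarrow> (case m s t of enat k \<Rightarrow> k dvd n | \<infinity> \<Rightarrow> n = 0)" for n
    using ev_alternating_double_eq_0[OF assms, of n] by simp
  show ?thesis
  proof (cases "m s t")
    case (enat k)
    then have "2 \<le> k" using two_le assms by simp
    then have "(LEAST n. n > 0 \<and> k dvd n) = k"
      by (intro Least_equality) (auto intro: dvd_imp_le)
    then show ?thesis
      using enat \<open>2 \<le> k\<close> by (auto simp: group_order_def * intro!: exI[of _ k])
  qed (auto simp: group_order_def *)
qed

section \<open>Reduced words in dihedral subgroups\<close>

lemma alternating_if_reduced:
  assumes "xs \<in> lists {a, b}" "length xs = len (ev xs)"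
  shows "\<exists>n. xs = alternating a b n \<or> xs = alternating b a n"
  using assms
proof (induction xs rule: list.induct)
  case Nil
  show ?case by (intro exI[of _ 0]) simp
next
  case (Cons x xs)
  have "length xs = len (ev xs)"
    using Cons.prems(2) len_ev_le[of xs] len_r_add_le[of "ev xs" x] by simp
  then obtain n where n: "xs = alternating a b n \<or> xs = alternating b a n"
    using Cons by auto
  have hd: "xs \<noteq> x # ys" for ys
    using Cons.prems(2) len_ev_le[of ys] by auto
  have x: "x = a \<or> x = b"
    using Cons.prems(1) by simp
  show ?case
  proof (cases n)
    case 0
    then show ?thesis using n x by (intro exI[of _ 1]) auto
  next
    case (Suc n')
    then have "x # xs = alternating a b (Suc n) \<or> x # xs = alternating b a (Suc n)"
      using n x hd by auto
    then show ?thesis by blast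
  qed
qed

lemma in_dihedralE:
  assumes "v \<in> parabolic {a, b}"
  obtains n where "n = len v" "v = ev (alternating a b n) \<or> v = ev (alternating b a n)"
proof -
  obtain xs where xs: "xs \<in> lists {a, b}" "ev xs = v" "length xs = len v"
    using assms by (rule parabolic_reducedE)
  then obtain n where "xs = alternating a b n \<or> xs = alternating b a n"
    using alternating_if_reduced[of xs a b] by auto
  then show ?thesis using that[of n] xs by auto
qed

text \<open>In a longer word, a braid move after the first letter creates a repeated letter, which
  cancels.\<close>

lemma alternating_reduced_le:
  assumes "a \<noteq> b" "m a b = enat k" "len (ev (alternating a b n)) = n"
  shows "n \<le> k"
proof (rule ccontr)
  assume "\<not> n \<le> k"
  then obtain j where j: "n = Suc k + j" by (metis less_iff_Suc_add not_le add_Suc)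
  obtain k' where k': "k = Suc k'" using two_le[OF assms(1,2)] by (cases k) auto
  define ys where "ys = (if even (Suc k) then alternating a b j else alternating b a j)"
  have "alternating a b n = a # alternating b a k @ ys"
    unfolding j alternating_add[of a b "Suc k" j] ys_def by simp
  moreover have "ev (alternating b a k) = r a + ev (alternating b a k')"
    using braid[OF assms(1,2)] k' by simp
  ultimately have "ev (alternating a b n) = ev (alternating b a k' @ ys)"
    by (simp add: add.assoc)
  moreover have "length (alternating b a k' @ ys) = k' + j"
    by (simp add: ys_def)
  ultimately have "len (ev (alternating a b n)) \<le> k' + j"
    using len_ev_le by metis
  then show False using assms(3) j k' by simp
qed

text \<open>The image under \<open>w\<close> of the simple root of \<open>s\<close>, given by its
  reflection and its sign: \<open>True\<close> means negative, that is, \<open>w + r s\<close> is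
  shorter than \<open>w\<close>.\<close>

definition root :: "'w \<Rightarrow> 'a \<Rightarrow> 'w \<times> bool" where
  "root w s = (w + r s - w, inversion w (w + r s - w))"

lemma root_0: "root 0 s = (r s, False)"
  by (simp add: root_def)

lemma root_eq_iff: "root w s = root w t \<longleftrightarrow> s = t"
  by (auto simp: root_def r_inject diff_eq_eq add.assoc)

lemma reflection_fst_root: "w \<in> W \<Longrightarrow> reflection (fst (root w s))"
  by (auto simp: root_def intro: reflection_conj)

text \<open>\<open>W\<close> acts on roots: by the cocycle rule the sign of the image depends only
  on \<open>w\<close> and on the root itself.\<close>

lemma root_add:
  assumes "root u s = root v t" "u \<in> W" "v \<in> W" "w \<in> W"
  shows "root (w + u) s = root (w + v) t"
proof -
  have *: "root (w + u') p =
      (w + fst (root u' p) - w, inversion w (w + fst (root u' p) - w) \<noteq> snd (root u' p))"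
    if "u' \<in> W" for u' p
  proof -
    have "- w + (w + (u' + r p - u') - w) + w = u' + r p - u'"
      by (simp add: group_word_simps del: add_uminus_conv_diff)
    then show ?thesis
      using that assms(4) by (simp add: root_def conj_add inversion_add)
  qed
  show ?thesis
    using assms by (simp add: *)
qed

lemma root_flip:
  assumes "w \<in> W"
  shows "root (w + r s) s = (fst (root w s), \<not> snd (root w s))"
proof -
  have "w + r s + r s - (w + r s) = w + r s - w" "- w + (w + r s - w) + w = r s"
    by (simp_all add: group_word_simps del: add_uminus_conv_diff)
  then show ?thesis
    using assms by (simp add: root_def inversion_add)
qed

text \<open>
  Conjugation by an element that maps a simple root to a simple root is a composite of
  conjugations by elements of rank two parabolics, which are covered by the hypothesis
  \<open>mixed\<close>.
\<close>

lemma conj_transport: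
  fixes h :: "'w \<Rightarrow> 'v::group_add" and \<sigma> :: "'a \<Rightarrow> 'v"
  assumes h: "\<And>u v. u \<in> W \<Longrightarrow> v \<in> W \<Longrightarrow> h (u + v) = h u + h v"
    and mixed: "\<And>s t k. s \<noteq> t \<Longrightarrow> m s t = enat k \<Longrightarrow>
      \<sigma> s + h (ev (alternating t s (k - 1))) =
      h (ev (alternating t s (k - 1))) + \<sigma> (if even k then s else t)"
    and "w \<in> W" "w + r s = r t + w" "\<not> inversion w (r t)"
  shows "h w + \<sigma> s = \<sigma> t + h w"
  using assms(3-5)
proof (induction "len w" arbitrary: w s rule: less_induct)
  case less
  have h0: "h 0 = 0"
    using h[of 0 0] by (metis add.right_neutral add_left_imp_eq zero_in_parabolic)
  have h_uminus: "h (- u) = - h u" if "u \<in> W" for u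
    using h[of u "- u"] that h0 by (simp add: W_closed eq_neg_iff_add_eq_0 minus_unique)
  show ?case
  proof (cases "w = 0")
    case True
    then show ?thesis using less.prems by (simp add: r_inject h0)
  next
    case False
    obtain xs where xs: "ev xs = w" "length xs = len w"
      using less.prems(1) by (rule reducedE)
    with False obtain ys q where "xs = ys @ [q]"
      by (metis ev_simps(1) rev_exhaust)
    then have "w + r q = ev ys" "length ys < len w"
      using xs by auto
    then have wq: "len (w + r q) < len w"
      using len_ev_le[of ys] by simp
    have ws: "len w < len (w + r s)"
      using less.prems by (simp add: inversion_iff_less(2))
    then have "q \<noteq> s" using wq by auto
    \<comment> \<open>Split off the part of \<open>w\<close> in the dihedral group of
      \<open>q\<close> and \<open>s\<close>. It is nontrivial because \<open>q\<close> shortens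
      \<open>w\<close>, and \<open>s\<close> still lengthens it.\<close>
    obtain d w0 where d: "d \<in> parabolic {q, s}" "w0 \<in> W" "w = w0 + d"
      and add: "\<And>v. v \<in> parabolic {q, s} \<Longrightarrow> len (w0 + v) = len w0 + len v"
      using parabolic_decomposition[OF less.prems(1), of "{q, s}"] by blast
    have dW: "d \<in> W" using d(1) by (rule parabolic_subset_W)
    have dp: "d + r q \<in> parabolic {q, s}" "d + r s \<in> parabolic {q, s}"
      using d(1) by (auto intro: parabolic_add)
    have dq: "len (d + r q) < len d"
      using wq add[OF d(1)] add[OF dp(1)] by (simp add: d(3) add.assoc)
    have ds: "len d < len (d + r s)"
      using ws add[OF d(1)] add[OF dp(2)] by (simp add: d(3) add.assoc)
    define t' where "t' = d + r s - d"
    have t': "t' \<in> parabolic {q, s}"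
      unfolding t'_def using dp(2) d(1) by (rule parabolic_diff)
    have w0t: "w0 + t' = r t + w0"
    proof -
      have "w0 + t' + d = r t + w0 + d"
        using less.prems(2) by (simp add: t'_def d(3) add.assoc)
      then show ?thesis by simp
    qed
    \<comment> \<open>\<open>w0 + t'\<close> has length \<open>len w0 + len t'\<close>, while
      \<open>r t + w0\<close> is at most one longer than \<open>w0\<close>.\<close>
    have "len t' \<le> 1"
      using add[OF t'] len_r_add_le[OF d(2), of t] by (simp add: w0t)
    moreover have "t' \<noteq> 0"
      using ds by (auto simp: t'_def diff_eq_eq)
    ultimately obtain p where p: "p \<in> {q, s}" "t' = r p"
      by (rule len_eq_1E[OF t'])
    define e where "e = - d"
    have e: "e \<in> parabolic {q, s}" "e \<in> W" "d = - e"
      using d(1) dW by (auto simp: e_def parabolic_uminus)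
    have lens: "len e = len d" "len (r s + e) = len (d + r s)"
      using len_uminus[OF dW] len_uminus[of "d + r s"] dW by (auto simp: e_def minus_add W_closed)
    have rse: "r s + e = e + r p"
      unfolding p(2)[symmetric] t'_def e_def
      by (simp add: group_word_simps del: add_uminus_conv_diff)
    obtain n where n: "n = len e" "e = ev (alternating q s n) \<or> e = ev (alternating s q n)"
      using e(1) by (rule in_dihedralE)
    have "n \<noteq> 0" using dq n(1) lens by auto
    then obtain n' where n': "n = Suc n'" by (cases n) auto
    have "e \<noteq> ev (alternating s q n)"
    proof
      assume "e = ev (alternating s q n)"
      then have "len (r s + e) \<le> n'"
        using len_ev_le[of "alternating q s n'"] by (simp add: n')
      then show False using ds lens n(1) n' by simp
    qed
    then have e_eq: "e = ev (alternating q s n)" using n(2) by blast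
    then have rs_e: "r s + e = ev (alternating s q (Suc n))" by simp
    then have len_rs_e: "len (r s + e) = Suc n"
      using ds lens n(1) len_ev_le[of "alternating s q (Suc n)"] by simp
    have p_eq: "p = (if even n then q else s)"
    proof (rule ccontr)
      assume "p \<noteq> (if even n then q else s)"
      then have "p = (if even n' then q else s)" using p(1) n' by auto
      then have "e + r p = ev (alternating q s n')"
        unfolding e_eq n' alternating_Suc_right by (simp add: add.assoc)
      then show False
        using len_rs_e rse len_ev_le[of "alternating q s n'"] n' by simp
    qed
    then have "ev (alternating s q (Suc n)) = ev (alternating q s (Suc n))"
      using rse rs_e e_eq by (simp only: alternating_Suc_right[of q s n] ev_simps) simp
    then have "ev (alternating s q (2 * Suc n)) = 0"
      by (simp only: alternating_double ev_simps ev_rev) simp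
    \<comment> \<open>The alternating words of length \<open>n + 1\<close> agree, so
      \<open>k\<close> divides \<open>n + 1\<close>; they are reduced, so
      \<open>n + 1 \<le> k\<close>. Hence \<open>e\<close> is the word of length
      \<open>k - 1\<close> occurring in \<open>mixed\<close>.\<close>
    then obtain k where k: "m s q = enat k" "k dvd Suc n"
      using ev_alternating_double_eq_0[of s q "Suc n"] \<open>q \<noteq> s\<close> by (cases "m s q") auto
    moreover have "Suc n \<le> k"
      using \<open>q \<noteq> s\<close> k(1) len_rs_e by (intro alternating_reduced_le[of s q]) (auto simp: rs_e)
    ultimately have "k = Suc n"
      by (simp add: dvd_imp_le le_antisym)
    then have "\<sigma> s + h e = h e + \<sigma> p"
      using mixed[of s q k] \<open>q \<noteq> s\<close> k(1) by (simp add: e_eq p_eq)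
    then have hd: "h d + \<sigma> s = \<sigma> p + h d"
      unfolding e(3) h_uminus[OF e(2)]
      by (metis add.assoc add_minus_cancel minus_add_cancel add_right_cancel)
    have "len w0 < len w"
      using add[OF d(1)] n(1) n' lens by (simp add: d(3))
    moreover have "\<not> inversion w0 (r t)"
      using inversion_decomposition[OF d(2) dW add[OF d(1)] reflection_r, of t] less.prems(3) d(3) by blast
    ultimately have "h w0 + \<sigma> p = \<sigma> t + h w0"
      using less.hyps[of w0 p] d(2) w0t p(2) by simp
    then show ?thesis
      using hd h[OF d(2) dW] by (simp add: d(3) add.assoc) (simp flip: add.assoc)
  qed
qed

text \<open>\<open>- v + u\<close> carries the simple root of \<open>s\<close> to that of
  \<open>t\<close>, which is the situation of \<open>conj_transport\<close>.\<close>

lemma root_transport: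
  fixes h :: "'w \<Rightarrow> 'v::group_add" and \<sigma> :: "'a \<Rightarrow> 'v"
  assumes h: "\<And>u v. u \<in> W \<Longrightarrow> v \<in> W \<Longrightarrow> h (u + v) = h u + h v"
    and mixed: "\<And>s t k. s \<noteq> t \<Longrightarrow> m s t = enat k \<Longrightarrow>
      \<sigma> s + h (ev (alternating t s (k - 1))) =
      h (ev (alternating t s (k - 1))) + \<sigma> (if even k then s else t)"
    and u: "u \<in> W" and v: "v \<in> W" and "root u s = root v t"
  shows "h u + \<sigma> s - h u = h v + \<sigma> t - h v"
proof -
  define w where "w = - v + u"
  have w: "w \<in> W" "u = v + w" using u v by (auto simp: w_def W_closed)
  have "root w s = root 0 t"
    using root_add[OF assms(5) u v W_closed(2)[OF v]] by (simp add: w_def)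
  then have "w + r s - w = r t" "\<not> inversion w (r t)"
    by (auto simp: root_def)
  then have "h w + \<sigma> s = \<sigma> t + h w"
    using w(1) by (intro conj_transport[OF h mixed]) (auto simp: diff_eq_eq)
  then have "h w + \<sigma> s - h w = \<sigma> t"
    by (simp add: diff_eq_eq)
  moreover have "h u = h v + h w"
    using h[OF v w(1)] w(2) by simp
  moreover have "h v + h w + \<sigma> s - (h v + h w) = h v + (h w + \<sigma> s - h w) - h v"
    by (simp add: group_word_simps del: add_uminus_conv_diff)
  ultimately show ?thesis by simp
qed

end

section \<open>The retraction onto a parabolic subgroup\<close>

context coxeter_system
begin

text \<open>
  Walking along a word through the cosets \<open>parabolic X + w\<close>, represented by \<open>w\<close> without
  inversions in \<open>X\<close>: a letter \<open>s\<close> that fixes the coset is recorded as the letter of \<open>X\<close>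
  to which \<open>w\<close> conjugates it.
\<close>

definition loop :: "'a set \<Rightarrow> 'w \<Rightarrow> 'a \<Rightarrow> bool" where
  "loop X w s \<longleftrightarrow> (\<exists>x\<in>X. w + r s = r x + w)"

definition label :: "'w \<Rightarrow> 'a \<Rightarrow> 'a" where
  "label w s = (THE x. w + r s = r x + w)"

fun trace :: "'a set \<Rightarrow> 'w \<Rightarrow> 'a list \<Rightarrow> 'a list" where
  "trace X w [] = []"
| "trace X w (s # xs) =
    (if loop X w s then label w s # trace X w xs else trace X (w + r s) xs)"

fun endpoint :: "'a set \<Rightarrow> 'w \<Rightarrow> 'a list \<Rightarrow> 'w" where
  "endpoint X w [] = w"
| "endpoint X w (s # xs) = endpoint X (if loop X w s then w else w + r s) xs"

definition minimal :: "'a set \<Rightarrow> 'w \<Rightarrow> bool" where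
  "minimal X w \<longleftrightarrow> w \<in> W \<and> (\<forall>x\<in>X. \<not> inversion w (r x))"

lemma label_eq: "w + r s = r x + w \<Longrightarrow> label w s = x"
  unfolding label_def by (rule the_equality) (auto simp: r_inject)

lemma loopE:
  assumes "loop X w s"
  obtains x where "x \<in> X" "label w s = x" "w + r s = r x + w"
  using assms label_eq unfolding loop_def by blast

lemma loop_add_r: "loop X (w + r s) s \<longleftrightarrow> loop X w s"
proof -
  have "w = r x + (w + r s) \<longleftrightarrow> w + r s = r x + w" for x
    by (metis add.assoc square_assoc)
  then show ?thesis by (simp add: loop_def)
qed

lemma minimal_0: "minimal X 0"
  by (simp add: minimal_def)

lemma minimal_step:
  assumes "minimal X w" "\<not> loop X w s"
  shows "minimal X (w + r s)"
proof -
  have "- w + r x + w = r s \<longleftrightarrow> w + r s = r x + w" for x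
    using conj_eq_iff[of w "r s" "r x"] by (auto simp: diff_eq_eq)
  then show ?thesis
    using assms by (auto simp: minimal_def W_closed inversion_add loop_def)
qed

text \<open>A recorded letter passes from the right of \<open>w\<close> to its left; an unrecorded
  one is absorbed into \<open>w\<close>. So equal traces of words with equal values have equal
  endpoints.\<close>

lemma trace_endpoint: "ev (trace X w xs) + endpoint X w xs = w + ev xs"
proof (induction xs arbitrary: w)
  case (Cons s xs)
  show ?case
  proof (cases "loop X w s")
    case True
    then obtain x where "label w s = x" "w + r s = r x + w" by (rule loopE)
    then show ?thesis
      using True Cons[of w] by (simp add: add.assoc) (simp flip: add.assoc)
  qed (use Cons[of "w + r s"] in \<open>simp add: add.assoc\<close>)
qed simp

text \<open>The tracked reflection is the conjugate of \<open>r x\<close> by the current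
  \<open>w\<close>. Recording \<open>x\<close> leaves both unchanged, so \<open>x\<close> is
  recorded exactly when the word meets that reflection; another recorded letter would break
  this.\<close>

lemma trace_single:
  assumes "x \<in> X" "set (trace X w xs) \<subseteq> {x}"
  shows "trace X w xs = replicate (count_list (reflections xs) (- w + r x + w)) x"
  using assms(2)
proof (induction xs arbitrary: w)
  case (Cons s xs)
  have eq: "r s = - w + r x + w \<longleftrightarrow> w + r s = r x + w"
    using conj_eq_iff[of w "r s" "r x"] by (auto simp: diff_eq_eq)
  have count: "count_list (reflections (s # xs)) (- w + r x + w) =
      (if w + r s = r x + w then 1 else 0) +
      count_list (reflections xs) (- (w + r s) + r x + (w + r s))"
  proof -
    have "- (w + r s) + r x + (w + r s) = - r s + (- w + r x + w) + r s"
      by (simp add: group_word_simps del: add_uminus_conv_diff)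
    then show ?thesis
      using eq by (auto simp only: reflections.simps count_list.simps count_list_conj split: if_splits)
  qed
  show ?case
  proof (cases "loop X w s")
    case True
    then obtain y where "label w s = y" "w + r s = r y + w" by (rule loopE)
    with True Cons.prems have *: "label w s = x" "w + r s = r x + w" by auto
    then have "- (w + r s) + r x + (w + r s) = - w + r x + w"
      unfolding *(2) by (simp add: group_word_simps del: add_uminus_conv_diff)
    then show ?thesis
      unfolding count using True Cons.IH[of w] Cons.prems * by simp
  next
    case False
    then have "w + r s \<noteq> r x + w" using assms(1) by (auto simp: loop_def)
    then show ?thesis
      unfolding count using False Cons.IH[of "w + r s"] Cons.prems by simp
  qed
qed simp

text \<open>
  Write \<open>w = w0 + d\<close> with \<open>d\<close> in the dihedral group of \<open>s\<close> and \<open>t\<close> and \<open>w0\<close> shortest. Every recorded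
  letter is the conjugate by \<open>w0\<close> of \<open>s\<close> or \<open>t\<close>. If both conjugates are in \<open>X\<close>, then \<open>d = 0\<close> and the
  walk does not move. If only one is, say \<open>x\<close>, then it is recorded as often as the conjugate of \<open>x\<close>
  by \<open>- w\<close> occurs among the reflections of the word, and the two words have the same reflections
  in opposite orders.
\<close>

lemma trace_alternating:
  assumes "minimal X w" "s \<noteq> t" "m s t = enat k"
  shows "endpoint X w (alternating s t k) = endpoint X w (alternating t s k)"
    and "trace X w (alternating s t k) = trace X w (alternating t s k) \<or>
      (\<exists>x\<in>X. \<exists>y\<in>X. x \<noteq> y \<and> m x y = enat k \<and>
        trace X w (alternating s t k) = alternating x y k \<and>
        trace X w (alternating t s k) = alternating y x k)"
proof -
  have wW: "w \<in> W" using assms(1) by (simp add: minimal_def)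
  obtain d w0 where d: "d \<in> parabolic {s, t}" "w0 \<in> W" "w = w0 + d"
    and add: "\<And>v. v \<in> parabolic {s, t} \<Longrightarrow> len (w0 + v) = len w0 + len v"
    using parabolic_decomposition[OF wW, of "{s, t}"] by blast
  have brd: "ev (alternating s t k) = ev (alternating t s k)"
    using braid assms by blast
  define J where "J = {x\<in>X. \<exists>j\<in>{s, t}. w0 + r j = r x + w0}"
  have label: "label (w0 + d') q \<in> J"
    if d': "d' \<in> parabolic {s, t}" and q: "q \<in> {s, t}" and lp: "loop X (w0 + d') q" for d' q
  proof -
    obtain x where x: "x \<in> X" "label (w0 + d') q = x" "w0 + d' + r q = r x + (w0 + d')"
      using lp by (rule loopE)
    define t' where "t' = d' + r q - d'"
    have t': "t' \<in> parabolic {s, t}"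
      unfolding t'_def using d' q by (intro parabolic_diff parabolic_add) auto
    have w0t: "w0 + t' = r x + w0"
    proof -
      have "w0 + t' + d' = r x + w0 + d'"
        using x(3) by (simp add: t'_def add.assoc)
      then show ?thesis by simp
    qed
    have "t' \<noteq> 0"
    proof
      assume "t' = 0"
      then have "r x + w0 = 0 + w0" using w0t by simp
      then show False by (simp only: add_right_cancel r_neq_0)
    qed
    moreover have "len t' \<le> 1"
      using add[OF t'] len_r_add_le[OF d(2), of x] by (simp add: w0t)
    ultimately obtain j where "j \<in> {s, t}" "t' = r j"
      by (metis len_eq_1E[OF t'])
    then show ?thesis using x w0t by (auto simp: J_def)
  qed
  have out_J: "set (trace X (w0 + d') xs) \<subseteq> J"
    if "d' \<in> parabolic {s, t}" "set xs \<subseteq> {s, t}" for d' xs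
    using that
  proof (induction xs arbitrary: d')
    case (Cons q xs)
    have "d' + r q \<in> parabolic {s, t}"
      using Cons.prems by (intro parabolic_add) auto
    then show ?case
      using Cons.IH[of d'] Cons.IH[of "d' + r q"] Cons.prems label[of d' q]
      by (auto simp: add.assoc)
  qed simp
  have out_J': "set (trace X w (alternating s t k)) \<subseteq> J" "set (trace X w (alternating t s k)) \<subseteq> J"
    using out_J[OF d(1)] set_alternating[of s t k] set_alternating[of t s k] by (auto simp: d(3))
  have "trace X w (alternating s t k) = trace X w (alternating t s k) \<or>
      (\<exists>x\<in>X. \<exists>y\<in>X. x \<noteq> y \<and> m x y = enat k \<and>
        trace X w (alternating s t k) = alternating x y k \<and>
        trace X w (alternating t s k) = alternating y x k) \<and>
      endpoint X w (alternating s t k) = endpoint X w (alternating t s k)"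
  proof (cases "\<exists>x\<in>X. \<exists>y\<in>X. w0 + r s = r x + w0 \<and> w0 + r t = r y + w0")
    case True
    then obtain x y where xy: "x \<in> X" "y \<in> X" "w0 + r s = r x + w0" "w0 + r t = r y + w0"
      by blast
    \<comment> \<open>Otherwise \<open>w0\<close> conjugates the first letter of a reduced word for
      \<open>d\<close> to a letter of \<open>X\<close> that shortens \<open>w\<close>, against
      \<open>minimal\<close>.\<close>
    have "d = 0"
    proof (rule ccontr)
      assume "d \<noteq> 0"
      obtain xs where xs: "xs \<in> lists {s, t}" "ev xs = d" "length xs = len d"
        using d(1) by (rule parabolic_reducedE)
      then obtain j ys where ys: "xs = j # ys" "j \<in> {s, t}"
        using \<open>d \<noteq> 0\<close> by (cases xs) auto
      have jd: "r j + d = ev ys" using xs ys by auto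
      then have "len (r j + d) < len d"
        using len_ev_le[of ys] xs(3) ys by simp
      moreover have "r j + d \<in> parabolic {s, t}"
        using ys(2) d(1) by (intro parabolic_add) auto
      ultimately have less: "len (w0 + (r j + d)) < len w"
        using add d(1,3) by simp
      obtain z where z: "z \<in> X" "w0 + r j = r z + w0"
        using xy ys(2) by auto
      have "w0 + (r j + d) = r z + w"
        unfolding d(3) using z(2) by (metis add.assoc)
      then have "inversion w (r z)"
        using less wW by (simp add: inversion_iff_less(1))
      then show False using assms(1) z(1) by (auto simp: minimal_def)
    qed
    then have w: "w = w0" by (simp add: d(3))
    have walk: "trace X w xs = map (\<lambda>q. if q = s then x else y) xs \<and> endpoint X w xs = w"
      if "set xs \<subseteq> {s, t}" for xs
      using that
    proof (induction xs)
      case (Cons q xs)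
      then have "loop X w q" "label w q = (if q = s then x else y)"
        using xy by (auto simp: w loop_def intro: label_eq)
      then show ?case using Cons by auto
    qed simp
    have conj: "r x = w0 + r s - w0" "r y = w0 + r t - w0"
      using xy(3,4) by (simp_all add: eq_diff_eq)
    then have "x \<noteq> y"
      using assms(2) r_inject[of s t] by (metis add_diff_cancel_right' diff_add_cancel add_left_imp_eq)
    have "r x + r y = w0 + (r s + r t) - w0"
      unfolding conj by (simp add: group_word_simps del: add_uminus_conv_diff)
    \<comment> \<open>The entries are the orders of the conjugate elements \<open>r x + r y\<close>
      and \<open>r s + r t\<close>.\<close>
    then have "m x y = m s t"
      using group_order_conj[of w0 "r s + r t"] group_order_r[OF \<open>x \<noteq> y\<close>] group_order_r[OF assms(2)]
      by simp
    moreover have "set (alternating t s k) \<subseteq> {s, t}"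
      using set_alternating[of t s k] by auto
    ultimately show ?thesis
      using walk[OF set_alternating, of k] walk[of "alternating t s k"] xy \<open>x \<noteq> y\<close> assms(2,3)
      by (auto simp: map_alternating)
  next
    case False
    \<comment> \<open>Different elements of \<open>J\<close> would come from \<open>s\<close> and
      \<open>t\<close>, the case just excluded.\<close>
    have "x = x'" if J: "x \<in> J" "x' \<in> J" for x x'
    proof -
      obtain j j' where "j \<in> {s, t}" "w0 + r j = r x + w0" "j' \<in> {s, t}" "w0 + r j' = r x' + w0"
        using J unfolding J_def by blast
      moreover from this have "j = j'"
        using False J unfolding J_def by blast
      ultimately show ?thesis by (simp add: r_inject)
    qed
    then consider "J = {}" | x where "J = {x}" by blast
    then show ?thesis
    proof cases
      case 1
      then show ?thesis using out_J' by simp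
    next
      case (2 x)
      then have "x \<in> X" by (auto simp: J_def)
      then have "trace X w (alternating s t k) = trace X w (alternating t s k)"
        using trace_single[OF _ out_J'(1)[unfolded 2]] trace_single[OF _ out_J'(2)[unfolded 2]]
          reflections_alternating_rev[OF brd]
        by (simp add: count_list_rev)
      then show ?thesis ..
    qed
  qed
  moreover have "endpoint X w (alternating s t k) = endpoint X w (alternating t s k)"
    if "trace X w (alternating s t k) = trace X w (alternating t s k)"
    using trace_endpoint[of X w "alternating s t k"] trace_endpoint[of X w "alternating t s k"] that brd
    by (metis add_left_imp_eq)
  ultimately show "endpoint X w (alternating s t k) = endpoint X w (alternating t s k)"
    and "trace X w (alternating s t k) = trace X w (alternating t s k) \<or>
      (\<exists>x\<in>X. \<exists>y\<in>X. x \<noteq> y \<and> m x y = enat k \<and>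
        trace X w (alternating s t k) = alternating x y k \<and>
        trace X w (alternating t s k) = alternating y x k)"
    by blast+
qed

lemma label_in_parabolic:
  assumes "loop X w s" "w \<in> parabolic Y" "s \<in> Y"
  shows "label w s \<in> X \<inter> Y"
proof -
  obtain x where x: "x \<in> X" "label w s = x" "w + r s = r x + w"
    using assms(1) by (rule loopE)
  have "r x = w + r s - w" using x(3) by (simp add: eq_diff_eq)
  then have "r x \<in> parabolic Y"
    using assms by (auto intro!: parabolic_add parabolic_diff)
  then show ?thesis using x by simp
qed

end

section \<open>The Coxeter matrix of the roots\<close>

context coxeter_system
begin

text \<open>The mixed relations on the level of roots. The sign is positive because
  \<open>r s\<close> among the \<open>k - 1\<close> reflections of the word would make the order of
  \<open>r s + r t\<close> smaller than \<open>k\<close>.\<close>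

lemma root_mixed:
  assumes "s \<noteq> t" "m s t = enat k"
  shows "root (ev (alternating t s (k - 1))) (if even k then s else t) = root 0 s"
proof -
  define e where "e = ev (alternating t s (k - 1))"
  have k: "2 \<le> k" using two_le assms by simp
  then obtain k' where k': "k = Suc k'" by (cases k) auto
  have "e + r (if even k then s else t) = ev (alternating t s k)"
    unfolding e_def k' alternating_Suc_right by simp
  also have "\<dots> = r s + e"
    using braid[OF assms] by (simp add: e_def k')
  finally have conj: "e + r (if even k then s else t) - e = r s"
    by (simp add: diff_eq_eq)
  have "r s \<notin> set (reflections (alternating t s (k - 1)))"
  proof
    assume "r s \<in> set (reflections (alternating t s (k - 1)))"
    then obtain i where i: "i < k - 1" "r s = ev (alternating t s (2 * i + 1))"
      unfolding reflections_alternating by auto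
    have "alternating s t (2 * Suc i) = s # alternating t s (2 * i + 1)" by simp
    then have "ev (alternating s t (2 * Suc i)) = 0"
      using i(2)[symmetric] by (simp only: ev_simps square)
    then have "k dvd Suc i"
      using ev_alternating_double_eq_0[OF assms(1), of "Suc i"] assms(2) by (simp del: alternating.simps)
    then show False using i(1) k dvd_imp_le[of k "Suc i"] by simp
  qed
  then have "\<not> inversion e (r s)"
    by (simp add: e_def inversion_ev)
  then show ?thesis
    unfolding root_0 e_def[symmetric] root_def[of e] conj by simp
qed

text \<open>Two distinct roots are related only if one element of \<open>W\<close> carries simple
  roots to both. The order is invariant under conjugation, so the entry does not depend on that
  element.\<close>

definition root_matrix :: "'w \<times> bool \<Rightarrow> 'w \<times> bool \<Rightarrow> enat" where
  "root_matrix \<beta> \<gamma> =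
    (if \<beta> = \<gamma> then 1
     else if \<exists>w\<in>W. \<exists>s t. \<beta> = root w s \<and> \<gamma> = root w t then group_order (fst \<beta> + fst \<gamma>)
     else \<infinity>)"

lemma root_matrix_root:
  assumes "w \<in> W" "s \<noteq> t"
  shows "root_matrix (root w s) (root w t) = m s t"
proof -
  have "fst (root w s) + fst (root w t) = w + (r s + r t) - w"
    by (simp add: root_def group_word_simps del: add_uminus_conv_diff)
  then show ?thesis
    using assms by (auto simp: root_matrix_def root_eq_iff group_order_conj group_order_r)
qed

lemma root_matrix_finiteE:
  assumes "root_matrix \<beta> \<gamma> = enat k" "\<beta> \<noteq> \<gamma>"
  obtains w s t where "w \<in> W" "s \<noteq> t" "\<beta> = root w s" "\<gamma> = root w t" "m s t = enat k"
proof -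
  obtain w s t where *: "w \<in> W" "\<beta> = root w s" "\<gamma> = root w t"
    using assms unfolding root_matrix_def by (auto split: if_splits)
  moreover from this have "s \<noteq> t" using assms(2) by auto
  ultimately show ?thesis using that assms(1) root_matrix_root by metis
qed

lemma coxeter_matrix_root_matrix: "coxeter_matrix UNIV root_matrix"
proof -
  have "root_matrix \<beta> \<gamma> = root_matrix \<gamma> \<beta> \<and> 2 \<le> root_matrix \<beta> \<gamma>" if "\<beta> \<noteq> \<gamma>" for \<beta> \<gamma>
  proof (cases "\<exists>w\<in>W. \<exists>s t. \<beta> = root w s \<and> \<gamma> = root w t")
    case True
    then obtain w s t where *: "w \<in> W" "\<beta> = root w s" "\<gamma> = root w t" by blast
    moreover from this have "s \<noteq> t" using that by auto
    moreover have "2 \<le> m s t" using matrix \<open>s \<noteq> t\<close> by (auto simp: coxeter_matrix_def)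
    ultimately show ?thesis using root_matrix_root sym by metis
  next
    case False
    then have "\<not> (\<exists>w\<in>W. \<exists>s t. \<gamma> = root w s \<and> \<beta> = root w t)" by blast
    then show ?thesis using False that unfolding root_matrix_def by auto
  qed
  moreover have "root_matrix \<beta> \<beta> = 1" for \<beta>
    by (simp add: root_matrix_def)
  ultimately show ?thesis
    by (simp add: coxeter_matrix_def)
qed

definition roots :: "'a set \<Rightarrow> ('w \<times> bool) set" where
  "roots X = {root w x | w x. w \<in> parabolic X \<and> x \<in> X}"

text \<open>The common reflection lies in \<open>parabolic (X \<inter> Y)\<close> and is conjugate
  there to a generator \<open>r z\<close>; a wrong sign is repaired by appending
  \<open>r z\<close>.\<close>

lemma roots_Int: "roots X \<inter> roots Y \<subseteq> roots (X \<inter> Y)"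
proof
  fix \<beta> assume \<beta>: "\<beta> \<in> roots X \<inter> roots Y"
  have fst_in: "fst \<beta> \<in> parabolic Z" if "\<beta> \<in> roots Z" for Z
    using that by (auto simp: roots_def root_def intro!: parabolic_diff parabolic_add)
  have "reflection (fst \<beta>)"
    using \<beta> reflection_fst_root parabolic_subset_W by (auto simp: roots_def)
  moreover have "fst \<beta> \<in> parabolic (X \<inter> Y)"
    using \<beta> fst_in parabolic_Int by blast
  ultimately obtain v z where v: "v \<in> parabolic (X \<inter> Y)" "z \<in> X \<inter> Y" "fst \<beta> = v + r z - v"
    by (rule reflection_in_parabolicE)
  then have fst_eq: "fst (root v z) = fst \<beta>" by (simp add: root_def)
  show "\<beta> \<in> roots (X \<inter> Y)"
  proof (cases "snd (root v z) = snd \<beta>")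
    case True
    then have "\<beta> = root v z" using fst_eq by (simp add: prod_eq_iff)
    then show ?thesis using v unfolding roots_def by blast
  next
    case False
    then have "\<beta> = root (v + r z) z"
      using fst_eq root_flip[OF parabolic_subset_W[OF v(1)]] by (simp add: prod_eq_iff)
    moreover have "v + r z \<in> parabolic (X \<inter> Y)"
      using v by (intro parabolic_add) auto
    ultimately show ?thesis using v unfolding roots_def by blast
  qed
qed

lemma lift:
  fixes f :: "'a \<Rightarrow> 'v::group_add"
  assumes "\<And>s. f s + f s = 0"
    and "\<And>s t k. s \<noteq> t \<Longrightarrow> m s t = enat k \<Longrightarrow>
      sum_list (map f (alternating s t k)) = sum_list (map f (alternating t s k))"
  obtains h where "\<And>xs. h (ev xs) = sum_list (map f xs)"
    "\<And>u v. u \<in> W \<Longrightarrow> v \<in> W \<Longrightarrow> h (u + v) = h u + h v"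
proof -
  have fold: "fold (\<lambda>s v. v + f s) xs v = v + sum_list (map f xs)" for xs v
    by (induction xs arbitrary: v) (auto simp: add.assoc)
  define h where "h w = sum_list (map f (SOME xs. ev xs = w))" for w
  have h: "h (ev xs) = sum_list (map f xs)" for xs
  proof -
    have "ev (SOME ys. ev ys = ev xs) = ev xs" by (rule someI) simp
    then have "fold (\<lambda>s v. v + f s) (SOME ys. ev ys = ev xs) 0 = fold (\<lambda>s v. v + f s) xs 0"
      by (rule fold_eqI) (auto simp: fold assms(1) add.assoc intro: assms(2))
    then show ?thesis by (simp add: h_def fold)
  qed
  have "h (u + v) = h u + h v" if uv: "u \<in> W" "v \<in> W" for u v
  proof -
    obtain xs ys where "u = ev xs" "v = ev ys" using uv by (elim W_E)
    then show ?thesis using h[of "xs @ ys"] by (simp add: h)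
  qed
  with h that show ?thesis by blast
qed

end

text \<open>Indices outside \<open>S\<close> become free factors of order two of the Coxeter group.\<close>

definition extend_matrix :: "'s set \<Rightarrow> ('s \<Rightarrow> 's \<Rightarrow> enat) \<Rightarrow> 's \<Rightarrow> 's \<Rightarrow> enat" where
  "extend_matrix S m s t = (if s = t then 1 else if s \<in> S \<and> t \<in> S then m s t else \<infinity>)"

lemma coxeter_matrix_extend: "coxeter_matrix S m \<Longrightarrow> coxeter_matrix UNIV (extend_matrix S m)"
  by (auto simp: coxeter_matrix_def extend_matrix_def)

section \<open>Virtual Artin groups\<close>

lemma evaluate_uminus: "evaluate p (map (\<lambda>(g, b). (g, \<not> b)) (rev u)) = - evaluate p u"
  by (induction u) (auto simp: minus_add)

lemma va_generators_iff [simp]: "Sigma s \<in> va_generators X \<longleftrightarrow> s \<in> X" "Tau s \<in> va_generators X \<longleftrightarrow> s \<in> X"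
  by (auto simp: va_generators_def)

lemma words_va_generators_mono:
  "X \<subseteq> Y \<Longrightarrow> words (va_generators X) \<subseteq> words (va_generators Y)"
  unfolding words_def va_generators_def by (intro lists_mono) auto

text \<open>\<open>r\<close> generates the Coxeter group of the extended matrix, \<open>R\<close>
  the one over its roots, \<open>p\<close> the virtual Artin group.\<close>

locale virtual_artin =
  coxeter_system "extend_matrix S m" r +
  hat: coxeter_system "coxeter_system.root_matrix r" R +
  VA: group_presentation "va_generators S" "va_relations S m" p
  for S :: "'s set" and m :: "'s \<Rightarrow> 's \<Rightarrow> enat"
    and r :: "'s \<Rightarrow> 'w::group_add" and R :: "'w \<times> bool \<Rightarrow> 'h::group_add"
    and p :: "'s va_generator \<Rightarrow> 'v::group_add" +
  assumes matrix_S: "coxeter_matrix S m"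
begin

text \<open>The value 0 outside \<open>S\<close> respects all relations, since the extended matrix
  has no finite off-diagonal entries there.\<close>

definition \<sigma> :: "'s \<Rightarrow> 'v" where "\<sigma> s = (if s \<in> S then p (Sigma s) else 0)"
definition \<tau> :: "'s \<Rightarrow> 'v" where "\<tau> s = (if s \<in> S then p (Tau s) else 0)"

lemma extend_matrix_finite:
  assumes "s \<noteq> t" "extend_matrix S m s t = enat k"
  shows "s \<in> S" "t \<in> S" "m s t = enat k"
  using assms by (auto simp: extend_matrix_def split: if_splits)

lemma evaluate_sigma: "set xs \<subseteq> S \<Longrightarrow> evaluate p (map sigma xs) = sum_list (map \<sigma> xs)"
  by (induction xs) (auto simp: \<sigma>_def)

lemma evaluate_tau: "set xs \<subseteq> S \<Longrightarrow> evaluate p (map tau xs) = sum_list (map \<tau> xs)"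
  by (induction xs) (auto simp: \<tau>_def)

lemma map_sigma_words [simp]: "map sigma xs \<in> words (va_generators X) \<longleftrightarrow> set xs \<subseteq> X"
  by (induction xs) (auto simp: va_generators_def)

lemma map_tau_words [simp]: "map tau xs \<in> words (va_generators X) \<longleftrightarrow> set xs \<subseteq> X"
  by (induction xs) (auto simp: va_generators_def)

lemma set_alternating_subset: "s \<in> X \<Longrightarrow> t \<in> X \<Longrightarrow> set (alternating s t k) \<subseteq> X"
  using set_alternating[of s t k] by auto

lemma relation:
  assumes "(u, v) \<in> va_relations S m" "u \<in> words (va_generators S)" "v \<in> words (va_generators S)"
  shows "evaluate p u = evaluate p v"
  using assms VA.evaluate_eq_iff word_cong.rel by metis

lemma tau_square: "\<tau> s + \<tau> s = 0"
proof (cases "s \<in> S")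
  case True
  then have "evaluate p (map tau [s, s]) = evaluate p (map tau [])"
    by (intro relation) (auto simp: va_relations_def va_generators_def)
  then show ?thesis using True by (simp add: \<tau>_def)
qed (simp add: \<tau>_def)

lemma tau_braid:
  assumes "s \<noteq> t" "extend_matrix S m s t = enat k"
  shows "sum_list (map \<tau> (alternating s t k)) = sum_list (map \<tau> (alternating t s k))"
proof -
  note st = extend_matrix_finite[OF assms]
  have "evaluate p (map tau (alternating s t k)) = evaluate p (map tau (alternating t s k))"
  proof (rule relation)
    show "(map tau (alternating s t k), map tau (alternating t s k)) \<in> va_relations S m"
      unfolding map_alternating va_relations_def using st assms(1) by blast
  qed (simp_all add: set_alternating_subset st)
  then show ?thesis by (simp add: evaluate_tau set_alternating_subset st)
qed

lemma sigma_braid: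
  assumes "s \<noteq> t" "extend_matrix S m s t = enat k"
  shows "sum_list (map \<sigma> (alternating s t k)) = sum_list (map \<sigma> (alternating t s k))"
proof -
  note st = extend_matrix_finite[OF assms]
  have "evaluate p (map sigma (alternating s t k)) = evaluate p (map sigma (alternating t s k))"
  proof (rule relation)
    show "(map sigma (alternating s t k), map sigma (alternating t s k)) \<in> va_relations S m"
      unfolding map_alternating va_relations_def using st assms(1) by blast
  qed (simp_all add: set_alternating_subset st)
  then show ?thesis by (simp add: evaluate_sigma set_alternating_subset st)
qed

lemma mixed:
  assumes "s \<noteq> t" "extend_matrix S m s t = enat k"
  shows "\<sigma> s + sum_list (map \<tau> (alternating t s (k - 1))) =
    sum_list (map \<tau> (alternating t s (k - 1))) + \<sigma> (if even k then s else t)"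
proof -
  note st = extend_matrix_finite[OF assms]
  have "evaluate p ([sigma s] @ map tau (alternating t s (k - 1))) =
    evaluate p (map tau (alternating t s (k - 1)) @ [sigma (if even k then s else t)])"
  proof (rule relation)
    show "([sigma s] @ map tau (alternating t s (k - 1)),
        map tau (alternating t s (k - 1)) @ [sigma (if even k then s else t)]) \<in> va_relations S m"
      unfolding map_alternating va_relations_def using st assms(1) by blast
  qed (use st in \<open>auto simp: set_alternating_subset\<close>)
  then show ?thesis
    using st by (auto simp: evaluate_tau set_alternating_subset \<sigma>_def)
qed

section \<open>The Coxeter group and the conjugates of the \<open>\<sigma> s\<close> inside the
  virtual Artin group\<close>

definition lift_tau :: "'w \<Rightarrow> 'v" where
  "lift_tau = (SOME h. (\<forall>xs. h (ev xs) = sum_list (map \<tau> xs)) \<and>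
    (\<forall>u\<in>W. \<forall>v\<in>W. h (u + v) = h u + h v))"

lemma lift_tau:
  "lift_tau (ev xs) = sum_list (map \<tau> xs)"
  "u \<in> W \<Longrightarrow> v \<in> W \<Longrightarrow> lift_tau (u + v) = lift_tau u + lift_tau v"
proof -
  obtain h where h: "\<And>xs. h (ev xs) = sum_list (map \<tau> xs)"
    "\<And>u v. u \<in> W \<Longrightarrow> v \<in> W \<Longrightarrow> h (u + v) = h u + h v"
    using lift[of \<tau>, OF tau_square tau_braid] by blast
  have "(\<forall>xs. lift_tau (ev xs) = sum_list (map \<tau> xs)) \<and>
      (\<forall>u\<in>W. \<forall>v\<in>W. lift_tau (u + v) = lift_tau u + lift_tau v)"
    unfolding lift_tau_def by (rule someI[of _ h]) (simp add: h)
  then show "lift_tau (ev xs) = sum_list (map \<tau> xs)"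
    "u \<in> W \<Longrightarrow> v \<in> W \<Longrightarrow> lift_tau (u + v) = lift_tau u + lift_tau v"
    by auto
qed

lemma lift_tau_0 [simp]: "lift_tau 0 = 0"
  using lift_tau(1)[of "[]"] by simp

lemma lift_tau_r: "lift_tau (r s) = \<tau> s"
  using lift_tau(1)[of "[s]"] by simp

text \<open>The generators of the kernel of the map that kills the \<open>\<sigma> s\<close>, indexed by roots.\<close>

definition \<delta> :: "'w \<times> bool \<Rightarrow> 'v" where
  "\<delta> \<beta> = (SOME g. \<exists>w\<in>W. \<exists>s. \<beta> = root w s \<and> g = lift_tau w + \<sigma> s - lift_tau w)"

lemma \<delta>_root:
  assumes "w \<in> W"
  shows "\<delta> (root w s) = lift_tau w + \<sigma> s - lift_tau w"
proof -
  have "\<exists>g. \<exists>v\<in>W. \<exists>t. root w s = root v t \<and> g = lift_tau v + \<sigma> t - lift_tau v"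
    using assms by blast
  then have "\<exists>v\<in>W. \<exists>t. root w s = root v t \<and> \<delta> (root w s) = lift_tau v + \<sigma> t - lift_tau v"
    unfolding \<delta>_def by (rule someI_ex)
  then obtain v t where "v \<in> W" "root w s = root v t"
    "\<delta> (root w s) = lift_tau v + \<sigma> t - lift_tau v"
    by blast
  moreover have "lift_tau w + \<sigma> s - lift_tau w = lift_tau v + \<sigma> t - lift_tau v"
    using assms calculation(1,2)
    by (intro root_transport lift_tau(2)) (auto simp only: lift_tau(1) intro: mixed)
  ultimately show ?thesis by simp
qed

text \<open>A finite entry means that both roots come from simple roots by the same
  \<open>w\<close>, so this is a braid relation of the \<open>\<sigma> s\<close> conjugated by
  \<open>lift_tau w\<close>.\<close>

lemma \<delta>_braid:
  assumes "\<beta> \<noteq> \<gamma>" "root_matrix \<beta> \<gamma> = enat k"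
  shows "sum_list (map \<delta> (alternating \<beta> \<gamma> k)) = sum_list (map \<delta> (alternating \<gamma> \<beta> k))"
proof -
  obtain w s t where w: "w \<in> W" "s \<noteq> t" "\<beta> = root w s" "\<gamma> = root w t"
    "extend_matrix S m s t = enat k"
    using assms(2,1) by (rule root_matrix_finiteE)
  have conj: "sum_list (map \<delta> (map (root w) xs)) = lift_tau w + sum_list (map \<sigma> xs) - lift_tau w" for xs
    by (induction xs) (simp_all add: \<delta>_root[OF w(1)] group_word_simps del: add_uminus_conv_diff)
  show ?thesis
    using conj[of "alternating s t k"] conj[of "alternating t s k"] sigma_braid[OF w(2,5)]
    by (simp add: map_alternating w(3,4))
qed

definition subgroup_on :: "'s set \<Rightarrow> 'v set" where
  "subgroup_on X = evaluate p ` words (va_generators X)"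

lemma evaluate_in_subgroup_on: "u \<in> words (va_generators X) \<Longrightarrow> evaluate p u \<in> subgroup_on X"
  by (simp add: subgroup_on_def)

lemma subgroup_on_0: "0 \<in> subgroup_on X"
  using evaluate_in_subgroup_on[of "[]" X] by simp

lemma subgroup_on_add:
  assumes "a \<in> subgroup_on X" "b \<in> subgroup_on X"
  shows "a + b \<in> subgroup_on X"
proof -
  obtain u v where "u \<in> words (va_generators X)" "v \<in> words (va_generators X)"
    "a = evaluate p u" "b = evaluate p v"
    using assms by (auto simp: subgroup_on_def)
  then show ?thesis using evaluate_in_subgroup_on[of "u @ v" X] by simp
qed

lemma subgroup_on_uminus:
  assumes "a \<in> subgroup_on X"
  shows "- a \<in> subgroup_on X"
proof -
  obtain u where u: "u \<in> words (va_generators X)" "a = evaluate p u"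
    using assms by (auto simp: subgroup_on_def)
  have "map (\<lambda>(g, b). (g, \<not> b)) (rev u) \<in> words (va_generators X)"
    using u(1) by (auto simp: words_def)
  then show ?thesis
    using evaluate_in_subgroup_on u(2) by (fastforce simp flip: evaluate_uminus)
qed

lemma subgroup_on_diff: "a \<in> subgroup_on X \<Longrightarrow> b \<in> subgroup_on X \<Longrightarrow> a - b \<in> subgroup_on X"
  using subgroup_on_add[OF _ subgroup_on_uminus, of a X b] by simp

lemma lift_tau_in_subgroup_on:
  assumes "X \<subseteq> S" "w \<in> parabolic X"
  shows "lift_tau w \<in> subgroup_on X"
proof -
  obtain xs where xs: "xs \<in> lists X" "w = ev xs"
    using assms(2) unfolding parabolic_def by blast
  then have "lift_tau w = evaluate p (map tau xs)"
    using assms(1) by (subst evaluate_tau) (auto simp: lift_tau(1))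
  then show ?thesis
    using xs evaluate_in_subgroup_on[of "map tau xs" X] by auto
qed

lemma \<delta>_in_subgroup_on:
  assumes "X \<subseteq> S" "\<beta> \<in> roots X"
  shows "\<delta> \<beta> \<in> subgroup_on X"
proof -
  obtain w x where w: "w \<in> parabolic X" "x \<in> X" "\<beta> = root w x"
    using assms(2) by (auto simp: roots_def)
  have "\<sigma> x \<in> subgroup_on X"
    using evaluate_in_subgroup_on[of "map sigma [x]" X] w(2) assms(1)
    by (auto simp: \<sigma>_def)
  then show ?thesis
    using w lift_tau_in_subgroup_on[OF assms(1) w(1)]
    by (simp add: \<delta>_root parabolic_subset_W subgroup_on_add subgroup_on_diff)
qed

text \<open>
  The retraction onto the parabolic subgroup of \<open>X\<close>, letter by letter. A state \<open>(g, c, w)\<close>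
  consists of the image \<open>g\<close> so far (up to a factor in the copy of the Coxeter group), the
  coset representative \<open>c\<close>, and the image \<open>w\<close> under \<open>\<sigma> s \<mapsto> 1, \<tau> s \<mapsto> s\<close>.
\<close>

fun act :: "'s set \<Rightarrow> 's va_generator \<times> bool \<Rightarrow> 'v \<times> 'h \<times> 'w \<Rightarrow> 'v \<times> 'h \<times> 'w" where
  "act X (Tau s, b) (g, c, w) = (g, c, w + r s)"
| "act X (Sigma s, b) (g, c, w) =
    (if hat.loop (roots X) c (root w s)
     then (g + (if b then \<delta> (hat.label c (root w s)) else - \<delta> (hat.label c (root w s))), c, w)
     else (g, c + R (root w s), w))"

definition valid :: "'s set \<Rightarrow> 'v \<times> 'h \<times> 'w \<Rightarrow> bool" where
  "valid X = (\<lambda>(g, c, w). hat.minimal (roots X) c \<and> w \<in> W)"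

lemma valid_act: "valid X st \<Longrightarrow> valid X (act X a st)"
  by (cases "(X, a, st)" rule: act.cases) (auto simp: valid_def hat.minimal_step W_closed)

lemma valid_fold_act: "valid X st \<Longrightarrow> valid X (fold (act X) u st)"
  by (induction u arbitrary: st) (auto simp: valid_act)

lemma fold_act_tau: "fold (act X) (map tau xs) (g, c, w) = (g, c, w + ev xs)"
  by (induction xs arbitrary: w) (auto simp: add.assoc)

lemma fold_act_sigma:
  "fold (act X) (map sigma xs) (g, c, w) =
    (g + sum_list (map \<delta> (hat.trace (roots X) c (map (root w) xs))),
     hat.endpoint (roots X) c (map (root w) xs), w)"
  by (induction xs arbitrary: g c) (auto simp: add.assoc)

text \<open>A letter that moves \<open>c\<close> is undone by the same involution, and by
  \<open>hat.loop_add_r\<close> it is not a loop at the new position either.\<close>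

lemma act_cancel: "act X (a, \<not> b) (act X (a, b) st) = st"
  by (cases a; cases st; cases b) (auto simp: hat.loop_add_r add.assoc)

text \<open>For the \<open>\<sigma>\<close> braid relations, \<open>hat.trace_alternating\<close>
  bounds the change of the record by a braid relation, which \<open>\<delta>\<close> respects.
  Relations among the \<open>\<tau>\<close> affect only \<open>w\<close>. In a mixed relation both
  sides read the same root.\<close>

lemma fold_act_relation:
  assumes "(u, v) \<in> va_relations S m" "valid X st"
  shows "fold (act X) u st = fold (act X) v st"
proof -
  obtain g c w where st: "st = (g, c, w)" by (cases st)
  have c: "hat.minimal (roots X) c" and w: "w \<in> W"
    using assms(2) by (auto simp: valid_def st)
  have fin: "extend_matrix S m s t = enat k" if "s \<in> S" "t \<in> S" "s \<noteq> t" "m s t = enat k" for s t k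
    using that by (simp add: extend_matrix_def)
  from assms(1) consider
    (sigma) s t k where "s \<in> S" "t \<in> S" "s \<noteq> t" "m s t = enat k"
      "u = map sigma (alternating s t k)" "v = map sigma (alternating t s k)"
  | (square) s where "u = map tau [s, s]" "v = []"
  | (tau) s t k where "s \<in> S" "t \<in> S" "s \<noteq> t" "m s t = enat k"
      "u = map tau (alternating s t k)" "v = map tau (alternating t s k)"
  | (mixed) s t k where "s \<in> S" "t \<in> S" "s \<noteq> t" "m s t = enat k"
      "u = [sigma s] @ map tau (alternating t s (k - 1))"
      "v = map tau (alternating t s (k - 1)) @ [sigma (if even k then s else t)]"
    unfolding va_relations_def map_alternating by fastforce
  then show ?thesis
  proof cases
    case sigma
    let ?\<beta> = "root w s" and ?\<gamma> = "root w t"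
    have ne: "?\<beta> \<noteq> ?\<gamma>" using sigma by (simp add: root_eq_iff)
    have fin': "root_matrix ?\<beta> ?\<gamma> = enat k"
      using root_matrix_root[OF w sigma(3)] fin sigma by simp
    note * = hat.trace_alternating[OF c ne fin']
    from *(2) have "sum_list (map \<delta> (hat.trace (roots X) c (alternating ?\<beta> ?\<gamma> k))) =
        sum_list (map \<delta> (hat.trace (roots X) c (alternating ?\<gamma> ?\<beta> k)))"
    proof (elim disjE bexE conjE)
      fix x y
      assume "x \<noteq> y" "root_matrix x y = enat k"
        "hat.trace (roots X) c (alternating ?\<beta> ?\<gamma> k) = alternating x y k"
        "hat.trace (roots X) c (alternating ?\<gamma> ?\<beta> k) = alternating y x k"
      then show ?thesis using \<delta>_braid[of x y k] by simp
    qed simp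
    then show ?thesis
      using *(1) unfolding sigma(5,6) st fold_act_sigma by (simp add: map_alternating)
  next
    case square
    then show ?thesis by (simp add: st fold_act_tau del: list.map)
  next
    case tau
    then show ?thesis
      using braid[of s t k] fin by (simp add: st fold_act_tau)
  next
    case mixed
    let ?e = "ev (alternating t s (k - 1))" and ?p = "if even k then s else t"
    have root: "root (w + ?e) ?p = root w s"
      using root_add[OF root_mixed[of s t k] _ _ w] fin mixed by simp
    have "fold (act X) u st = fold (act X) (map tau (alternating t s (k - 1))) (act X (sigma s) st)"
      by (simp add: mixed)
    also have "\<dots> = act X (sigma ?p) (g, c, w + ?e)"
      unfolding st act.simps root by (simp only: fold_act_tau split: if_splits) simp
    also have "\<dots> = fold (act X) v st"
      by (simp add: mixed st fold_act_tau)
    finally show ?thesis .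
  qed
qed

lemma fold_act_cong:
  assumes "(u, v) \<in> word_cong (va_generators S) (va_relations S m)" "valid X st"
  shows "fold (act X) u st = fold (act X) v st"
  using assms
proof (induction arbitrary: st rule: word_cong.induct)
  case (append u u' v v')
  then show ?case by (simp add: valid_fold_act)
next
  case (cancel g b)
  then show ?case by (simp add: act_cancel)
next
  case (rel u v)
  then show ?case using fold_act_relation by blast
qed auto

text \<open>At \<open>c = 0\<close> every root of \<open>X\<close> is a loop labelled by itself, so
  the walk stays there. Moving a \<open>\<sigma>\<close> to the left across
  \<open>lift_tau w\<close> turns it into the recorded \<open>\<delta>\<close>.\<close>

lemma fold_act_inside:
  assumes "X \<subseteq> S" "u \<in> words (va_generators X)"
  shows "\<exists>g. \<exists>w\<in>parabolic X. fold (act X) u (0, 0, 0) = (g, 0, w) \<and> evaluate p u = g + lift_tau w"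
  using assms(2)
proof (induction u rule: rev_induct)
  case Nil
  show ?case by (intro exI[of _ 0] bexI[of _ 0]) auto
next
  case (snoc a u)
  then obtain g w where IH: "w \<in> parabolic X" "fold (act X) u (0, 0, 0) = (g, 0, w)"
    "evaluate p u = g + lift_tau w"
    by auto
  have w: "w \<in> W" using IH(1) by (rule parabolic_subset_W)
  obtain x b where a: "(a = (Sigma x, b) \<or> a = (Tau x, b))" "x \<in> X" "x \<in> S"
    using snoc.prems assms(1) by (cases a) (auto simp: va_generators_def)
  from a(1) show ?case
  proof
    assume a': "a = (Sigma x, b)"
    have "root w x \<in> roots X" using IH(1) a(2) by (auto simp: roots_def)
    then have "hat.loop (roots X) 0 (root w x)" "hat.label 0 (root w x) = root w x"
      by (auto simp: hat.loop_def intro: hat.label_eq)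
    then have "fold (act X) (u @ [a]) (0, 0, 0) =
        (g + (if b then \<delta> (root w x) else - \<delta> (root w x)), 0, w)"
      by (simp add: IH(2) a')
    moreover have "evaluate p (u @ [a]) =
        g + (if b then \<delta> (root w x) else - \<delta> (root w x)) + lift_tau w"
      using a(3) by (simp add: IH(3) a' \<delta>_root[OF w] \<sigma>_def group_word_simps del: add_uminus_conv_diff)
    ultimately show ?thesis using IH(1) by blast
  next
    assume a': "a = (Tau x, b)"
    have "- \<tau> x = \<tau> x" by (rule minus_unique[OF tau_square])
    then have "evaluate p (u @ [a]) = g + lift_tau (w + r x)"
      using a(3) by (auto simp: IH(3) a' lift_tau(2)[OF w r_in_W] lift_tau_r \<tau>_def add.assoc)
    moreover have "fold (act X) (u @ [a]) (0, 0, 0) = (g, 0, w + r x)"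
      by (simp add: IH(2) a')
    moreover have "w + r x \<in> parabolic X"
      using IH(1) a(2) by (intro parabolic_add) auto
    ultimately show ?thesis by blast
  qed
qed

text \<open>As \<open>c\<close> and \<open>w\<close> stay in the parabolic subgroups of
  \<open>Y\<close>, every label is in \<open>roots X \<inter> roots Y\<close>, hence comes from
  \<open>X \<inter> Y\<close>.\<close>

lemma fold_act_outside:
  assumes "X \<subseteq> S" "Y \<subseteq> S" "u \<in> words (va_generators Y)"
  shows "\<exists>g\<in>subgroup_on (X \<inter> Y). \<exists>c\<in>hat.parabolic (roots Y). \<exists>w\<in>parabolic Y.
    fold (act X) u (0, 0, 0) = (g, c, w)"
  using assms(3)
proof (induction u rule: rev_induct)
  case Nil
  show ?case
    by (intro bexI[of _ 0]) (auto simp: subgroup_on_0)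
next
  case (snoc a u)
  then obtain g c w where IH: "g \<in> subgroup_on (X \<inter> Y)" "c \<in> hat.parabolic (roots Y)"
    "w \<in> parabolic Y" "fold (act X) u (0, 0, 0) = (g, c, w)"
    by auto
  obtain y b where a: "(a = (Sigma y, b) \<or> a = (Tau y, b))" "y \<in> Y"
    using snoc.prems by (cases a) (auto simp: va_generators_def)
  from a(1) show ?case
  proof
    assume a': "a = (Sigma y, b)"
    have root: "root w y \<in> roots Y" using IH(3) a(2) by (auto simp: roots_def)
    show ?thesis
    proof (cases "hat.loop (roots X) c (root w y)")
      case True
      let ?\<gamma> = "hat.label c (root w y)"
      have "?\<gamma> \<in> roots (X \<inter> Y)"
        using hat.label_in_parabolic[OF True IH(2) root] roots_Int by blast
      then have "\<delta> ?\<gamma> \<in> subgroup_on (X \<inter> Y)"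
        using assms(1) by (intro \<delta>_in_subgroup_on) auto
      then have "g + (if b then \<delta> ?\<gamma> else - \<delta> ?\<gamma>) \<in> subgroup_on (X \<inter> Y)"
        using IH(1) by (simp add: subgroup_on_add subgroup_on_diff)
      moreover have "fold (act X) (u @ [a]) (0, 0, 0) = (g + (if b then \<delta> ?\<gamma> else - \<delta> ?\<gamma>), c, w)"
        using True by (simp add: IH(4) a')
      ultimately show ?thesis using IH(2,3) by blast
    next
      case False
      then have "fold (act X) (u @ [a]) (0, 0, 0) = (g, c + R (root w y), w)"
        by (simp add: IH(4) a')
      moreover have "c + R (root w y) \<in> hat.parabolic (roots Y)"
        using IH(2) root by (intro hat.parabolic_add) auto
      ultimately show ?thesis using IH(1,3) by blast
    qed
  next
    assume a': "a = (Tau y, b)"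
    have "fold (act X) (u @ [a]) (0, 0, 0) = (g, c, w + r y)"
      by (simp add: IH(4) a')
    moreover have "w + r y \<in> parabolic Y"
      using IH(3) a(2) by (intro parabolic_add) auto
    ultimately show ?thesis using IH(1,2) by blast
  qed
qed

lemma subgroup_on_Int:
  assumes "X \<subseteq> S" "Y \<subseteq> S"
  shows "subgroup_on X \<inter> subgroup_on Y \<subseteq> subgroup_on (X \<inter> Y)"
proof
  fix a assume "a \<in> subgroup_on X \<inter> subgroup_on Y"
  then obtain u v where u: "u \<in> words (va_generators X)" "a = evaluate p u"
    and v: "v \<in> words (va_generators Y)" "a = evaluate p v"
    by (auto simp: subgroup_on_def)
  have "u \<in> words (va_generators S)" "v \<in> words (va_generators S)"
    using u(1) v(1) assms words_va_generators_mono by blast+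
  then have "(u, v) \<in> word_cong (va_generators S) (va_relations S m)"
    using VA.evaluate_eq_iff[of u v] u(2) v(2) by simp
  moreover have "valid X (0, 0, 0)"
    by (simp add: valid_def hat.minimal_0)
  ultimately have eq: "fold (act X) u (0, 0, 0) = fold (act X) v (0, 0, 0)"
    by (rule fold_act_cong)
  obtain g w where g: "w \<in> parabolic X" "fold (act X) u (0, 0, 0) = (g, 0, w)"
    "evaluate p u = g + lift_tau w"
    using fold_act_inside[OF assms(1) u(1)] by blast
  obtain g' c w' where g': "g' \<in> subgroup_on (X \<inter> Y)" "w' \<in> parabolic Y"
    "fold (act X) v (0, 0, 0) = (g', c, w')"
    using fold_act_outside[OF assms v(1)] by blast
  \<comment> \<open>Reading \<open>v\<close> places \<open>g\<close> in the subgroup of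
    \<open>X \<inter> Y\<close>, and both words together place \<open>w\<close> there; reading
    \<open>u\<close> recovers \<open>a\<close> from \<open>g\<close> and \<open>w\<close>.\<close>
  have "g' = g" "w' = w" using eq g(2) g'(3) by auto
  then have "w \<in> parabolic (X \<inter> Y)" using g(1) g'(2) parabolic_Int by blast
  then have "lift_tau w \<in> subgroup_on (X \<inter> Y)"
    using assms(1) by (intro lift_tau_in_subgroup_on) auto
  then show "a \<in> subgroup_on (X \<inter> Y)"
    using u(2) g(3) g'(1) \<open>g' = g\<close> by (simp add: subgroup_on_add)
qed

end

section \<open>From values of words back to the generated subgroups\<close>

lemma va_parabolic_eq:
  assumes "X \<subseteq> S"
  shows "va_parabolic S m X =
    word_class (va_generators S) (va_relations S m) ` words (va_generators X)"
proof -
  let ?A = "va_generators S" and ?R = "va_relations S m"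
  let ?G = "presented_group ?A ?R" and ?cl = "word_class ?A ?R"
  let ?H = "(\<lambda>g. ?cl [(g, True)]) ` va_generators X"
  interpret group ?G by (rule group_presented_group)
  have sub: "u \<in> words ?A" if "u \<in> words (va_generators X)" for u
    using that assms words_va_generators_mono by blast
  have inv_class: "m_inv ?G (?cl [(g, True)]) = ?cl [(g, False)]" if g: "g \<in> va_generators X" for g
  proof (rule inv_equality)
    have gA: "g \<in> ?A" using g assms by (auto simp: va_generators_def)
    have "(([(g, False), (g, True)]), []) \<in> word_cong ?A ?R"
      using word_cong.cancel[OF gA, of False] by simp
    then show "?cl [(g, False)] \<otimes>\<^bsub>?G\<^esub> ?cl [(g, True)] = \<one>\<^bsub>?G\<^esub>"
      using gA by (simp add: mult_word_class one_presented_group word_class_eq_iff)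
    show "?cl [(g, True)] \<in> carrier ?G" "?cl [(g, False)] \<in> carrier ?G"
      using gA by (auto simp: carrier_presented_group)
  qed
  have "generate ?G ?H = ?cl ` words (va_generators X)"
  proof
    show "generate ?G ?H \<subseteq> ?cl ` words (va_generators X)"
    proof
      fix x assume "x \<in> generate ?G ?H"
      then show "x \<in> ?cl ` words (va_generators X)"
      proof induction
        case one
        show ?case by (intro image_eqI[of _ _ "[]"]) (auto simp: one_presented_group)
      next
        case (incl h)
        then obtain g where "g \<in> va_generators X" "h = ?cl [(g, True)]" by blast
        then show ?case by (intro image_eqI[of _ _ "[(g, True)]"]) auto
      next
        case (inv h)
        then obtain g where "g \<in> va_generators X" "h = ?cl [(g, True)]" by blast
        then show ?case using inv_class by (intro image_eqI[of _ _ "[(g, False)]"]) auto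
      next
        case (eng h1 h2)
        then obtain u v where "u \<in> words (va_generators X)" "v \<in> words (va_generators X)"
          "h1 = ?cl u" "h2 = ?cl v" by blast
        then show ?case
          using sub by (intro image_eqI[of _ _ "u @ v"]) (auto simp: mult_word_class)
      qed
    qed
    have "?cl u \<in> generate ?G ?H" if "u \<in> words (va_generators X)" for u
      using that
    proof (induction u)
      case Nil
      show ?case using generate.one[of ?G ?H] by (simp add: one_presented_group)
    next
      case (Cons a u)
      obtain g b where a: "a = (g, b)" "g \<in> va_generators X"
        using Cons.prems by (cases a) auto
      have "?cl [a] \<in> generate ?G ?H"
        using a inv_class[of g] generate.incl[of "?cl [(g, True)]" ?H ?G] generate.inv[of "?cl [(g, True)]" ?H ?G]
        by (cases b) auto
      moreover have "?cl u \<in> generate ?G ?H" using Cons by simp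
      ultimately have "?cl [a] \<otimes>\<^bsub>?G\<^esub> ?cl u \<in> generate ?G ?H" by (rule generate.eng)
      then show ?case using sub[of "[a]"] sub[of u] Cons.prems by (simp add: mult_word_class)
    qed
    then show "?cl ` words (va_generators X) \<subseteq> generate ?G ?H" by blast
  qed
  then show ?thesis by (simp add: va_parabolic_def virtual_artin_group_def)
qed

theorem theorem1p2:
  fixes S X Y :: "'s set" and m :: "'s \<Rightarrow> 's \<Rightarrow> enat"
  assumes "finite S" and "coxeter_matrix S m"
    and "X \<subseteq> S" and "Y \<subseteq> S"
  shows "va_parabolic S m X \<inter> va_parabolic S m Y = va_parabolic S m (X \<inter> Y)"
proof
  let ?A = "va_generators S" and ?R = "va_relations S m"
  obtain r :: "'s \<Rightarrow> 's word set symmetry"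
    where "group_presentation UNIV (coxeter_relations (extend_matrix S m)) r"
    using ex_group_presentation by blast
  then interpret cox: coxeter_system "extend_matrix S m" r
    by (intro coxeter_system.intro coxeter_system_axioms.intro coxeter_matrix_extend assms(2))
  obtain R :: "_ \<Rightarrow> ('s word set symmetry \<times> bool) word set symmetry"
    where "group_presentation UNIV (coxeter_relations cox.root_matrix) R"
    using ex_group_presentation by blast
  then interpret hat: coxeter_system cox.root_matrix R
    by (intro coxeter_system.intro coxeter_system_axioms.intro cox.coxeter_matrix_root_matrix)
  obtain p :: "'s va_generator \<Rightarrow> 's va_generator word set symmetry"
    where "group_presentation ?A ?R p"
    using ex_group_presentation by blast
  then interpret VA: group_presentation ?A ?R p .
  interpret virtual_artin S m r R p
    by unfold_locales (rule assms(2))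
  have sub: "u \<in> words ?A" if "u \<in> words (va_generators Z)" "Z \<subseteq> S" for u Z
    using that words_va_generators_mono by blast
  show "va_parabolic S m X \<inter> va_parabolic S m Y \<subseteq> va_parabolic S m (X \<inter> Y)"
  proof
    fix C assume "C \<in> va_parabolic S m X \<inter> va_parabolic S m Y"
    then obtain u v where u: "u \<in> words (va_generators X)" "C = word_class ?A ?R u"
      and v: "v \<in> words (va_generators Y)" "C = word_class ?A ?R v"
      using assms by (auto simp: va_parabolic_eq)
    then have "evaluate p u = evaluate p v"
      using sub assms by (simp add: VA.evaluate_eq_iff flip: word_class_eq_iff)
    then have "evaluate p u \<in> subgroup_on X \<inter> subgroup_on Y"
      using u(1) v(1) by (metis IntI evaluate_in_subgroup_on)
    then have "evaluate p u \<in> subgroup_on (X \<inter> Y)"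
      using subgroup_on_Int[OF assms(3,4)] by blast
    then obtain z where z: "z \<in> words (va_generators (X \<inter> Y))" "evaluate p u = evaluate p z"
      by (auto simp: subgroup_on_def)
    have "u \<in> words ?A" "z \<in> words ?A"
      using sub[OF u(1)] sub[OF z(1)] assms by auto
    then have "C = word_class ?A ?R z"
      using z(2) u(2) by (simp add: VA.evaluate_eq_iff word_class_eq_iff)
    then show "C \<in> va_parabolic S m (X \<inter> Y)"
      using z(1) assms(3) by (subst va_parabolic_eq) auto
  qed
  have "words (va_generators (X \<inter> Y)) \<subseteq> words (va_generators X) \<inter> words (va_generators Y)"
    by (simp add: words_va_generators_mono)
  moreover have "X \<inter> Y \<subseteq> S" using assms(3) by blast
  ultimately show "va_parabolic S m (X \<inter> Y) \<subseteq> va_parabolic S m X \<inter> va_parabolic S m Y"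
    using assms by (auto simp: va_parabolic_eq)
qed

end
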